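(* Let $S$ be a compact, connected, orientable surface of genus $g\ge0$ with $p>0$ boundary components. Let $\alpha\in P_n(S)$ be a braid given as a word $w$ of length $m$ in the generators $\{A_{i,j}^{\pm1}\}_{i<j}$. Then, for every $k=1,\dots,n$, there is an algorithm of complexity $O((g+p+n)m)$ which produces a compressed word $\mathbb A_k$ of size at most $19(2g+p+n)m$ and terminal characters $\{A_{i,j_k}^{\pm1}\}_{i<j_k}$, where $j_k=(2g+p-1)+k$, whose evaluation represents $\alpha_k$, the $k$-th factor of the combed normal form of $\alpha$.
   Context: **Compressed words.** A compressed word (straight line program) $\mathbb A$ consists of a finite alphabet $\mathcal F$ of terminal characters, an ordered finite set $\mathcal A=\{A_1<\dots<A_N\}$ of non-terminal symbols disjoint from $\mathcal F$, and production rules $A_i\to W_i$ ($1\le i\le N$), where $W_i\in(\mathcal F\cup\mathcal A)^*$ is a (possibly empty) word in which every non-terminal $A_j$ that appears has $j<i$. The greatest symbol $A_N$ is the root. The evaluation $ev(\mathbb A)$ is the word in $\mathcal F$ obtained by replacing successively non-terminals by their productions starting from the root. The size is $|\mathbb A|=\sum_i|W_i|$. **The group.** $P_n(S)$ is the pure braid group with $n$ strands on $S$ (fundamental group of the configuration space of ordered $n$-tuples of distinct points of $S$). It is generated by $\{A_{i,j}\mid 2g+p\le j\le 2g+p+n-1,\ 1\le i<j\}$ subject to the defining relations (known presentation) (PR1) $A_{i,j}^{-1}A_{r,s}A_{i,j}=A_{r,s}$ if $i<j<r<s$, or $r+1<i<j<s$, or ($i=r+1<j<s$ with $r\ge 2g$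 or $r$ even); (PR2) $A_{i,j}^{-1}A_{j,s}A_{i,j}=A_{i,s}A_{j,s}A_{i,s}^{-1}$ if $i<j<s$; (PR3) $A_{i,j}^{-1}A_{i,s}A_{i,j}=A_{i,s}A_{j,s}A_{i,s}A_{j,s}^{-1}A_{i,s}^{-1}$ if $i<j<s$; (PR4) $A_{i,j}^{-1}A_{r,s}A_{i,j}=A_{i,s}A_{j,s}A_{i,s}^{-1}A_{j,s}^{-1}A_{r,s}A_{j,s}A_{i,s}A_{j,s}^{-1}A_{i,s}^{-1}$ if $i+1<r<j<s$, or ($i+1=r<j<s$ with $r>2g$ or $r$ odd); (ER1) $A_{r+1,j}^{-1}A_{r,s}A_{r+1,j}=A_{r,s}A_{r+1,s}A_{j,s}^{-1}A_{r+1,s}^{-1}$ if $r$ odd, $r<2g$, $j<s$; (ER2) $A_{r-1,j}^{-1}A_{r,s}A_{r-1,j}=A_{r-1,s}A_{j,s}A_{r-1,s}^{-1}A_{r,s}A_{j,s}A_{r-1,s}A_{j,s}^{-1}A_{r-1,s}^{-1}$ if $r$ even, $r\le 2g$, $j<s$. **Combed normal form.** With $j_k=(2g+p-1)+k$, the subgroup generated by $\{A_{i,j_k}\}_{i<j_k}$ is free on these generators, and every $\alpha\in P_n(S)$ has a unique decomposition $\alpha=\alpha_1\alpha_2\cdots\alpha_n$ with $\alpha_k$ in that subgroup for each $k$; this is its combed normal form. Complexity is counted in elementary operations, where handling a single letter, symbol or index counts as one operation. *)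

theory Defs
  imports "HOL-Algebra.Generated_Groups"
begin

section \<open>Groups given by generators and relations\<close>

text \<open>A letter is a generator with a sign: \<^term>\<open>(x, True)\<close> stands for $x$ and
  \<^term>\<open>(x, False)\<close> for $x^{-1}$.\<close>

type_synonym 'a letter = "'a \<times> bool"

abbreviation words :: "'a set \<Rightarrow> 'a letter list set" where
  "words X \<equiv> lists (X \<times> UNIV)"

inductive pres_eq ::
  "'a set \<Rightarrow> ('a letter list \<times> 'a letter list) set \<Rightarrow> 'a letter list \<Rightarrow> 'a letter list \<Rightarrow> bool"
  for X R where
  refl: "u \<in> words X \<Longrightarrow> pres_eq X R u u"
| sym: "pres_eq X R u v \<Longrightarrow> pres_eq X R v u"
| trans: "pres_eq X R u v \<Longrightarrow> pres_eq X R v w \<Longrightarrow> pres_eq X R u w"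
| cancel: "u \<in> words X \<Longrightarrow> v \<in> words X \<Longrightarrow> x \<in> X
    \<Longrightarrow> pres_eq X R (u @ [(x, b), (x, \<not> b)] @ v) (u @ v)"
| rel: "u \<in> words X \<Longrightarrow> v \<in> words X \<Longrightarrow> (l, r) \<in> R \<Longrightarrow> l \<in> words X \<Longrightarrow> r \<in> words X
    \<Longrightarrow> pres_eq X R (u @ l @ v) (u @ r @ v)"

definition pres_class ::
  "'a set \<Rightarrow> ('a letter list \<times> 'a letter list) set \<Rightarrow> 'a letter list \<Rightarrow> 'a letter list set" where
  "pres_class X R u = {v. pres_eq X R u v}"

definition presented_group ::
  "'a set \<Rightarrow> ('a letter list \<times> 'a letter list) set \<Rightarrow> 'a letter list set monoid" where
  "presented_group X R =
    \<lparr> carrier = pres_class X R ` words X,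
      monoid.mult = (\<lambda>U V. \<Union>u\<in>U. \<Union>v\<in>V. pres_class X R (u @ v)),
      one = pres_class X R [] \<rparr>"

lemma pres_eq_words: "pres_eq X R u v \<Longrightarrow> u \<in> words X \<and> v \<in> words X"
  by (induction rule: pres_eq.induct) auto

lemma pres_eq_context:
  assumes "pres_eq X R u v" "a \<in> words X" "b \<in> words X"
  shows "pres_eq X R (a @ u @ b) (a @ v @ b)"
  using assms(1)
proof (induction rule: pres_eq.induct)
  case (refl u)
  then show ?case using assms by (intro pres_eq.refl) auto
next
  case (sym u v)
  then show ?case by (blast intro: pres_eq.sym)
next
  case (trans u v w)
  then show ?case by (blast intro: pres_eq.trans)
next
  case (cancel u v x c)
  then show ?case using pres_eq.cancel[of "a @ u" X "v @ b" x R c] assms by simp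
next
  case (rel u v l r)
  then show ?case using pres_eq.rel[of "a @ u" X "v @ b" l r R] assms by simp
qed

lemma pres_eq_append:
  assumes "pres_eq X R u u'" "pres_eq X R v v'"
  shows "pres_eq X R (u @ v) (u' @ v')"
  using pres_eq_context[OF assms(1), of "[]" v] pres_eq_context[OF assms(2), of u' "[]"]
    pres_eq_words[OF assms(1)] pres_eq_words[OF assms(2)]
  by (auto intro: pres_eq.trans)

lemma pres_class_eq_iff:
  "u \<in> words X \<Longrightarrow> pres_class X R u = pres_class X R v \<longleftrightarrow> pres_eq X R u v"
  unfolding pres_class_def by (auto intro: pres_eq.intros)

lemma pres_class_mult:
  assumes "u \<in> words X" "v \<in> words X"
  shows "pres_class X R u \<otimes>\<^bsub>presented_group X R\<^esub> pres_class X R v = pres_class X R (u @ v)"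
proof -
  have *: "pres_class X R (u' @ v') = pres_class X R (u @ v)"
    if "u' \<in> pres_class X R u" "v' \<in> pres_class X R v" for u' v'
  proof -
    have "pres_eq X R (u @ v) (u' @ v')"
      using that pres_eq_append by (auto simp: pres_class_def)
    then show ?thesis using assms pres_class_eq_iff[of "u @ v" X R "u' @ v'"] by auto
  qed
  have "u \<in> pres_class X R u" "v \<in> pres_class X R v"
    using assms by (auto simp: pres_class_def intro: pres_eq.refl)
  then have "(\<Union>u'\<in>pres_class X R u. \<Union>v'\<in>pres_class X R v. pres_class X R (u' @ v'))
      = pres_class X R (u @ v)"
    using * by blast
  then show ?thesis by (simp add: presented_group_def)
qed

lemma pres_eq_inverse:
  "u \<in> words X \<Longrightarrow> pres_eq X R (rev (map (\<lambda>(x, b). (x, \<not> b)) u) @ u) []"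
proof (induction u)
  case Nil
  then show ?case by (auto intro: pres_eq.refl)
next
  case (Cons l u)
  obtain x b where l: "l = (x, b)" by fastforce
  have "rev (map (\<lambda>(x, b). (x, \<not> b)) u) \<in> words X"
    using Cons.prems by (auto simp: in_lists_conv_set)
  then have "pres_eq X R (rev (map (\<lambda>(x, b). (x, \<not> b)) u) @ [(x, \<not> b), (x, \<not> \<not> b)] @ u)
      (rev (map (\<lambda>(x, b). (x, \<not> b)) u) @ u)"
    using Cons.prems l by (intro pres_eq.cancel) auto
  then show ?case using Cons l by (auto intro: pres_eq.trans)
qed

lemma group_presented_group: "group (presented_group X R)"
proof (rule groupI)
  fix U V W
  assume "U \<in> carrier (presented_group X R)" "V \<in> carrier (presented_group X R)"
    "W \<in> carrier (presented_group X R)"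
  then obtain u v w where "U = pres_class X R u" "V = pres_class X R v" "W = pres_class X R w"
    "u \<in> words X" "v \<in> words X" "w \<in> words X"
    by (auto simp: presented_group_def)
  then show "U \<otimes>\<^bsub>presented_group X R\<^esub> V \<otimes>\<^bsub>presented_group X R\<^esub> W
      = U \<otimes>\<^bsub>presented_group X R\<^esub> (V \<otimes>\<^bsub>presented_group X R\<^esub> W)"
    by (simp add: pres_class_mult)
next
  fix U V
  assume "U \<in> carrier (presented_group X R)" "V \<in> carrier (presented_group X R)"
  then obtain u v where "U = pres_class X R u" "V = pres_class X R v"
    "u \<in> words X" "v \<in> words X"
    by (auto simp: presented_group_def)
  moreover from this have "u @ v \<in> words X" by simp
  ultimately have "U \<otimes>\<^bsub>presented_group X R\<^esub> V \<in> pres_class X R ` words X"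
    by (metis pres_class_mult imageI)
  then show "U \<otimes>\<^bsub>presented_group X R\<^esub> V \<in> carrier (presented_group X R)"
    by (simp add: presented_group_def)
next
  show "\<one>\<^bsub>presented_group X R\<^esub> \<in> carrier (presented_group X R)"
    by (simp add: presented_group_def)
next
  fix U assume "U \<in> carrier (presented_group X R)"
  then obtain u where u: "U = pres_class X R u" "u \<in> words X"
    by (auto simp: presented_group_def)
  have one: "\<one>\<^bsub>presented_group X R\<^esub> = pres_class X R []" by (simp add: presented_group_def)
  show "\<one>\<^bsub>presented_group X R\<^esub> \<otimes>\<^bsub>presented_group X R\<^esub> U = U"
    using u by (simp add: one pres_class_mult)
  let ?u' = "rev (map (\<lambda>(x, b). (x, \<not> b)) u)"
  have u': "?u' \<in> words X" using u(2) by (auto simp: in_lists_conv_set)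
  have "pres_class X R ?u' \<otimes>\<^bsub>presented_group X R\<^esub> U = \<one>\<^bsub>presented_group X R\<^esub>"
    using u u' pres_eq_inverse[OF u(2)]
    by (simp add: one pres_class_mult pres_class_eq_iff)
  moreover have "pres_class X R ?u' \<in> carrier (presented_group X R)"
    using u' by (simp add: presented_group_def)
  ultimately show "\<exists>V\<in>carrier (presented_group X R).
      V \<otimes>\<^bsub>presented_group X R\<^esub> U = \<one>\<^bsub>presented_group X R\<^esub>"
    by blast
qed


section \<open>Pure braid groups of surfaces with boundary\<close>

text \<open>The generator $A_{i,j}$ is the pair \<^term>\<open>(i, j)\<close>.\<close>

definition gens :: "nat \<Rightarrow> nat \<Rightarrow> nat \<Rightarrow> (nat \<times> nat) set" where
  "gens g p n = {(i, j). 2*g + p \<le> j \<and> j \<le> 2*g + p + n - 1 \<and> 1 \<le> i \<and> i < j}"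

abbreviation A :: "nat \<Rightarrow> nat \<Rightarrow> (nat \<times> nat) letter" where
  "A i j \<equiv> ((i, j), True)"

abbreviation A' :: "nat \<Rightarrow> nat \<Rightarrow> (nat \<times> nat) letter" where
  "A' i j \<equiv> ((i, j), False)"

inductive_set braid_rels ::
  "nat \<Rightarrow> nat \<Rightarrow> nat \<Rightarrow> ((nat \<times> nat) letter list \<times> (nat \<times> nat) letter list) set"
  for g p n :: nat where
  PR1: "(i, j) \<in> gens g p n \<Longrightarrow> (r, s) \<in> gens g p n \<Longrightarrow>
    (i < j \<and> j < r \<and> r < s) \<or> (r + 1 < i \<and> i < j \<and> j < s) \<or>
    (i = r + 1 \<and> r + 1 < j \<and> j < s \<and> (r \<ge> 2*g \<or> even r)) \<Longrightarrow>
    ([A' i j, A r s, A i j], [A r s]) \<in> braid_rels g p n"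
| PR2: "(i, j) \<in> gens g p n \<Longrightarrow> (j, s) \<in> gens g p n \<Longrightarrow> i < j \<and> j < s \<Longrightarrow>
    ([A' i j, A j s, A i j], [A i s, A j s, A' i s]) \<in> braid_rels g p n"
| PR3: "(i, j) \<in> gens g p n \<Longrightarrow> (i, s) \<in> gens g p n \<Longrightarrow> i < j \<and> j < s \<Longrightarrow>
    ([A' i j, A i s, A i j], [A i s, A j s, A i s, A' j s, A' i s]) \<in> braid_rels g p n"
| PR4: "(i, j) \<in> gens g p n \<Longrightarrow> (r, s) \<in> gens g p n \<Longrightarrow>
    (i + 1 < r \<and> r < j \<and> j < s) \<or>
    (i + 1 = r \<and> r < j \<and> j < s \<and> (r > 2*g \<or> odd r)) \<Longrightarrow>
    ([A' i j, A r s, A i j],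
     [A i s, A j s, A' i s, A' j s, A r s, A j s, A i s, A' j s, A' i s]) \<in> braid_rels g p n"
| ER1: "(r + 1, j) \<in> gens g p n \<Longrightarrow> (r, s) \<in> gens g p n \<Longrightarrow>
    odd r \<and> r < 2*g \<and> j < s \<Longrightarrow>
    ([A' (r + 1) j, A r s, A (r + 1) j],
     [A r s, A (r + 1) s, A' j s, A' (r + 1) s]) \<in> braid_rels g p n"
| ER2: "(r - 1, j) \<in> gens g p n \<Longrightarrow> (r, s) \<in> gens g p n \<Longrightarrow>
    even r \<and> r \<le> 2*g \<and> j < s \<Longrightarrow>
    ([A' (r - 1) j, A r s, A (r - 1) j],
     [A (r - 1) s, A j s, A' (r - 1) s, A r s, A j s, A (r - 1) s, A' j s, A' (r - 1) s])
      \<in> braid_rels g p n"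

text \<open>$P_n(S)$ for the compact connected orientable surface $S$ of genus $g$ with $p > 0$
  boundary components, given by its known presentation.\<close>

definition pure_braid_group :: "nat \<Rightarrow> nat \<Rightarrow> nat \<Rightarrow> (nat \<times> nat) letter list set monoid" where
  "pure_braid_group g p n = presented_group (gens g p n) (braid_rels g p n)"

definition braid :: "nat \<Rightarrow> nat \<Rightarrow> nat \<Rightarrow> (nat \<times> nat) letter list \<Rightarrow> (nat \<times> nat) letter list set" where
  "braid g p n w = pres_class (gens g p n) (braid_rels g p n) w"

definition strand_index :: "nat \<Rightarrow> nat \<Rightarrow> nat \<Rightarrow> nat" where
  "strand_index g p k = (2*g + p - 1) + k"

definition strand_subgroup :: "nat \<Rightarrow> nat \<Rightarrow> nat \<Rightarrow> nat \<Rightarrow> (nat \<times> nat) letter list set set" where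
  "strand_subgroup g p n k =
    generate (pure_braid_group g p n)
      {braid g p n [A i (strand_index g p k)] | i. 1 \<le> i \<and> i < strand_index g p k}"

text \<open>The factors $\alpha_1, \dots, \alpha_n$ are listed in this order, so that $\alpha_k$ sits at
  list position $k - 1$.\<close>

definition is_combed ::
  "nat \<Rightarrow> nat \<Rightarrow> nat \<Rightarrow> (nat \<times> nat) letter list set \<Rightarrow> (nat \<times> nat) letter list set list \<Rightarrow> bool" where
  "is_combed g p n \<alpha> \<alpha>s \<longleftrightarrow>
    length \<alpha>s = n \<and>
    (\<forall>k\<in>{1..n}. \<alpha>s ! (k - 1) \<in> strand_subgroup g p n k) \<and>
    foldr (\<lambda>x y. x \<otimes>\<^bsub>pure_braid_group g p n\<^esub> y) \<alpha>s \<one>\<^bsub>pure_braid_group g p n\<^esub> = \<alpha>"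

definition combed_factor ::
  "nat \<Rightarrow> nat \<Rightarrow> nat \<Rightarrow> nat \<Rightarrow> (nat \<times> nat) letter list set \<Rightarrow> (nat \<times> nat) letter list set" where
  "combed_factor g p n k \<alpha> = (THE \<alpha>s. is_combed g p n \<alpha> \<alpha>s) ! (k - 1)"


section \<open>Compressed words\<close>

datatype 'f sym = Term 'f | NonTerm nat

text \<open>A compressed word is the list of its productions $W_1, \dots, W_N$: the nonterminal $A_i$ is
  \<^term>\<open>NonTerm i\<close>, and $W_i$ sits at list position $i - 1$.\<close>

type_synonym 'f compressed = "'f sym list list"

definition compressed_word :: "'f set \<Rightarrow> 'f compressed \<Rightarrow> bool" where
  "compressed_word F Ws \<longleftrightarrow>
    finite F \<and> Ws \<noteq> [] \<and>
    (\<forall>i\<in>{1..length Ws}. \<forall>x\<in>set (Ws ! (i - 1)).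
      (case x of Term a \<Rightarrow> a \<in> F | NonTerm j \<Rightarrow> 1 \<le> j \<and> j < i))"

definition compressed_size :: "'f compressed \<Rightarrow> nat" where
  "compressed_size Ws = (\<Sum>W\<leftarrow>Ws. length W)"

definition replace_nonterm :: "nat \<Rightarrow> 'f sym list \<Rightarrow> 'f sym list \<Rightarrow> 'f sym list" where
  "replace_nonterm i W u = concat (map (\<lambda>x. if x = NonTerm i then W else [x]) u)"

text \<open>Successively replaces $A_i, A_{i-1}, \dots, A_1$ by their productions.\<close>

primrec expand :: "'f compressed \<Rightarrow> nat \<Rightarrow> 'f sym list \<Rightarrow> 'f sym list" where
  "expand Ws 0 u = u"
| "expand Ws (Suc i) u = expand Ws i (replace_nonterm (Suc i) (Ws ! i) u)"

definition ev :: "'f compressed \<Rightarrow> 'f list" where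
  "ev Ws = concat (map (case_sym (\<lambda>a. [a]) (\<lambda>_. []))
    (expand Ws (length Ws) [NonTerm (length Ws)]))"


section \<open>Random access programs and their running time\<close>

text \<open>Programs work on registers and on zero-initialised arrays, all holding natural numbers.
  Every instruction and every test costs one step. Arithmetic is restricted to successor and
  predecessor, so that a number stays as small as an index: in $t$ steps it can exceed the
  numbers of the input and of the program by at most $t$, and no data can be packed into it.\<close>

datatype test = Eq nat nat | Less nat nat

datatype com =
    Skip
  | Set nat nat         \<comment> \<open>register := constant\<close>
  | Copy nat nat        \<comment> \<open>register := register\<close>
  | Inc nat
  | Dec nat
  | Load nat nat nat    \<comment> \<open>\<open>Load x a y\<close>: register \<open>x\<close> := array \<open>a\<close> at position (register \<open>y\<close>)\<close>
  | Store nat nat nat   \<comment> \<open>\<open>Store a y x\<close>: array \<open>a\<close> at position (register \<open>y\<close>) := register \<open>x\<close>\<close>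
  | Seq com com
  | Cond test com com
  | While test com

type_synonym state = "(nat \<Rightarrow> nat) \<times> (nat \<Rightarrow> nat \<Rightarrow> nat)"

fun test_val :: "test \<Rightarrow> state \<Rightarrow> bool" where
  "test_val (Eq x y) (\<rho>, \<mu>) = (\<rho> x = \<rho> y)"
| "test_val (Less x y) (\<rho>, \<mu>) = (\<rho> x < \<rho> y)"

inductive runs :: "com \<Rightarrow> state \<Rightarrow> nat \<Rightarrow> state \<Rightarrow> bool" where
  Skip: "runs Skip s 1 s"
| Set: "runs (Set x c) (\<rho>, \<mu>) 1 (\<rho>(x := c), \<mu>)"
| Copy: "runs (Copy x y) (\<rho>, \<mu>) 1 (\<rho>(x := \<rho> y), \<mu>)"
| Inc: "runs (Inc x) (\<rho>, \<mu>) 1 (\<rho>(x := \<rho> x + 1), \<mu>)"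
| Dec: "runs (Dec x) (\<rho>, \<mu>) 1 (\<rho>(x := \<rho> x - 1), \<mu>)"
| Load: "runs (Load x a y) (\<rho>, \<mu>) 1 (\<rho>(x := \<mu> a (\<rho> y)), \<mu>)"
| Store: "runs (Store a y x) (\<rho>, \<mu>) 1 (\<rho>, \<mu>(a := (\<mu> a)(\<rho> y := \<rho> x)))"
| Seq: "runs c s t s' \<Longrightarrow> runs d s' t' s'' \<Longrightarrow> runs (Seq c d) s (t + t') s''"
| CondTrue: "test_val b s \<Longrightarrow> runs c s t s' \<Longrightarrow> runs (Cond b c d) s (t + 1) s'"
| CondFalse: "\<not> test_val b s \<Longrightarrow> runs d s t s' \<Longrightarrow> runs (Cond b c d) s (t + 1) s'"
| WhileFalse: "\<not> test_val b s \<Longrightarrow> runs (While b c) s 1 s"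
| WhileTrue: "test_val b s \<Longrightarrow> runs c s t s' \<Longrightarrow> runs (While b c) s' t' s''
    \<Longrightarrow> runs (While b c) s (t + t' + 1) s''"

text \<open>The input is a list of numbers in array 0, the output a list of numbers in array 1.
  Only an initial segment of array 1 is prescribed; this suffices because the encoding of
  compressed words below is self-delimiting.\<close>

definition initial_state :: "nat list \<Rightarrow> state" where
  "initial_state xs = (\<lambda>_. 0, \<lambda>a i. if a = 0 \<and> i < length xs then xs ! i else 0)"

definition has_output :: "state \<Rightarrow> nat list \<Rightarrow> bool" where
  "has_output s ys \<longleftrightarrow> (\<forall>i<length ys. snd s 1 i = ys ! i)"

fun encode_letter :: "(nat \<times> nat) letter \<Rightarrow> nat list" where
  "encode_letter ((i, j), b) = [i, j, if b then 1 else 0]"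

definition encode_input :: "nat \<Rightarrow> nat \<Rightarrow> nat \<Rightarrow> nat \<Rightarrow> (nat \<times> nat) letter list \<Rightarrow> nat list" where
  "encode_input g p n k w = [g, p, n, k, length w] @ concat (map encode_letter w)"

fun encode_sym :: "(nat \<times> nat) letter sym \<Rightarrow> nat list" where
  "encode_sym (Term ((i, j), b)) = [i, j, if b then 1 else 0]"
| "encode_sym (NonTerm q) = [q, 0, 2]"

definition encode_compressed :: "(nat \<times> nat) letter compressed \<Rightarrow> nat list" where
  "encode_compressed Ws =
    length Ws # concat (map (\<lambda>W. length W # concat (map encode_sym W)) Ws)"

end

theory Submission
  imports Defs
begin

text \<open>
Fix $k$, put $s = j_k$, and write $x_r$ for $A_{r,s}$. Call the letters with second index $s$ the
letters of strand $s$.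

\<^emph>\<open>The factor.\<close> Every defining relation conjugates a letter $A_{r,s}$ by some $A_{i,j}$ with $j < s$
and gives a word in letters of strand $s$. Hence deleting all letters whose second index exceeds a
bound $J$ respects the relations (\<open>braid_eq_upto_strand\<close>). Applied to $\alpha_1 \cdots \alpha_n$
with $J = j_k$ this leaves $\alpha_1 \cdots \alpha_k$. So if $w_k$ denotes what remains of $w$, then
$\alpha_k = w_{k-1}^{-1} w_k$ is the only possible factor (\<open>combed_factors_unique\<close>), and it is the
factor as soon as this element is a product of letters of strand $s$.

\<^emph>\<open>The compressed word.\<close> Read $w$ from right to left, and let $\beta$ be the product of the letters of
strands before $s$ that have been read. The invariant \<open>tracks\<close> says that for every $r < s$ there are
nonterminals with values $\beta^{-1} x_r \beta$ and $\beta^{-1} x_r^{-1} \beta$, and that the last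
nonterminal has the value $\beta^{-1} v$, where $v$ is the part read so far without the letters of
strands after $s$. When a letter $x_i^{\pm 1}$ of strand $s$ is read, the last value is multiplied by
$\beta^{-1} x_i^{\pm 1} \beta$, which takes one production of length 2. When a letter
$l = A_{i,j}^{\pm 1}$ with $j < s$ is read, $\beta$ becomes $l \beta$, and one needs
$l^{-1} x_r l$ as a word in the $x_q$. All relations, and all their inverse forms, turn out to have the shape
$l^{-1} x_r l = L x_r M$, where $L$ and $M$ are trivial or one of three words $D$, $C$, $E$ in $x_i$ and
$x_j$ or an inverse of them (\<open>braid_eq_conj\<close>). These six words get nonterminals of their own, with
18 symbols in total, and then each of the new $2(s-1)$ nonterminals has a production of length 3. One
more symbol repeats the root. At the end of $w$ the root has the value $w_{k-1}^{-1} w_k$.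

With the $2(s-1)$ initial productions of length 1 the size is at most
$2(s-1) + m(6(s-1) + 19)$, and $s - 1 \le 2g+p+n-2$.

\<^emph>\<open>The algorithm.\<close> The program writes these productions one after another. An array holds for each $r$
the number of the nonterminal for $x_r$; the one for $x_r^{-1}$ is the next number. A letter thus
costs time $O(s)$. Correctness and running time are proved together, by symbolic execution
(\<open>wp\<close>) with an invariant for each loop.
\<close>

section \<open>Inverse words and conjugation in a presented group\<close>

abbreviation inv_letter :: "'a letter \<Rightarrow> 'a letter" where
  "inv_letter l \<equiv> (fst l, \<not> snd l)"

definition inv_word :: "'a letter list \<Rightarrow> 'a letter list" where
  "inv_word u = rev (map inv_letter u)"

lemma inv_word_simps [simp]:
  "inv_word [] = []"
  "inv_word (l # u) = inv_word u @ [inv_letter l]"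
  "inv_word (u @ v) = inv_word v @ inv_word u"
  "inv_word (inv_word u) = u"
  by (simp_all add: inv_word_def rev_map comp_def)

lemma inv_word_in_words [simp]: "inv_word u \<in> words X \<longleftrightarrow> u \<in> words X"
  by (induction u) auto

lemma pres_eq_left_inverse: "u \<in> words X \<Longrightarrow> pres_eq X R (inv_word u @ u) []"
  using pres_eq_inverse[of u X R] by (simp add: inv_word_def case_prod_unfold)

declare pres_eq.trans [trans]

lemma pres_eq_cancel_left:
  assumes "u \<in> words X" "b \<in> words X" "v \<in> words X"
  shows "pres_eq X R (u @ inv_word b @ b @ v) (u @ v)"
  using pres_eq_context[OF pres_eq_left_inverse[OF assms(2), of R] assms(1,3)] by simp

lemma pres_eq_cancel_right:
  assumes "u \<in> words X" "b \<in> words X" "v \<in> words X"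
  shows "pres_eq X R (u @ b @ inv_word b @ v) (u @ v)"
  using pres_eq_cancel_left[of u X "inv_word b" v R] assms by simp

lemma pres_eq_inv_word:
  assumes "pres_eq X R u v"
  shows "pres_eq X R (inv_word u) (inv_word v)"
proof -
  have w: "u \<in> words X" "v \<in> words X" using pres_eq_words[OF assms] by auto
  have "pres_eq X R (inv_word u) (inv_word u @ v @ inv_word v)"
    using pres_eq_cancel_right[of "inv_word u" X v "[]" R] w by (auto intro: pres_eq.sym)
  also have "pres_eq X R \<dots> (inv_word u @ u @ inv_word v)"
    using pres_eq_context[OF assms, of "inv_word u" "inv_word v"] w by (auto intro: pres_eq.sym)
  also have "pres_eq X R \<dots> (inv_word v)"
    using pres_eq_cancel_left[of "[]" X u "inv_word v" R] w by auto
  finally show ?thesis .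
qed

primrec freely_reduce :: "'a letter list \<Rightarrow> 'a letter list" where
  "freely_reduce [] = []"
| "freely_reduce (l # u) = (case freely_reduce u of [] \<Rightarrow> [l]
    | h # t \<Rightarrow> if h = inv_letter l then t else l # h # t)"

lemma pres_eq_freely_reduce: "u \<in> words X \<Longrightarrow> pres_eq X R u (freely_reduce u)"
proof (induction u)
  case Nil
  show ?case by (simp add: pres_eq.refl)
next
  case (Cons l u)
  then have l: "[l] \<in> words X" by auto
  have step: "pres_eq X R (l # u) (l # freely_reduce u)"
    using Cons pres_eq_context[of X R u "freely_reduce u" "[l]" "[]"] by auto
  show ?case
  proof (cases "freely_reduce u")
    case Nil
    then show ?thesis using step by simp
  next
    case (Cons h t)
    have "pres_eq X R (l # inv_letter l # t) t" if "h = inv_letter l"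
      using pres_eq_words[OF step] Cons that l pres_eq.cancel[of "[]" X t "fst l" R "snd l"]
      by auto
    then show ?thesis using step Cons pres_eq.trans by fastforce
  qed
qed

text \<open>Decides by evaluation the identities between explicit words that hold in every group.\<close>

lemma pres_eq_if_freely_equal:
  "u \<in> words X \<Longrightarrow> v \<in> words X \<Longrightarrow> freely_reduce u = freely_reduce v \<Longrightarrow> pres_eq X R u v"
  using pres_eq_freely_reduce by (metis pres_eq.sym pres_eq.trans)

lemma pres_eq_conj_append:
  assumes "x \<in> words X" "pres_eq X R (inv_word x @ u @ x) u'" "pres_eq X R (inv_word x @ v @ x) v'"
    "u \<in> words X" "v \<in> words X"
  shows "pres_eq X R (inv_word x @ (u @ v) @ x) (u' @ v')"
proof -
  have "pres_eq X R (inv_word x @ (u @ v) @ x) ((inv_word x @ u @ x) @ (inv_word x @ v @ x))"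
    using pres_eq_cancel_right[of "inv_word x @ u" X x "v @ x" R] assms by (auto intro: pres_eq.sym)
  also have "pres_eq X R \<dots> (u' @ v')" by (intro pres_eq_append assms)
  finally show ?thesis .
qed

lemma pres_eq_conj_inv:
  assumes "pres_eq X R (inv_word x @ u @ x) u'"
  shows "pres_eq X R (inv_word x @ inv_word u @ x) (inv_word u')"
  using pres_eq_inv_word[OF assms] by simp

text \<open>Reads off the conjugation by $x^{-1}$ from the conjugation by $x$.\<close>

lemma pres_eq_conj_flip:
  assumes "pres_eq X R (inv_word x @ u @ x) v"
  shows "pres_eq X R (x @ v @ inv_word x) u"
proof -
  have w: "x \<in> words X" "u \<in> words X" "v \<in> words X" using pres_eq_words[OF assms] by auto
  have "pres_eq X R (x @ v @ inv_word x) (x @ (inv_word x @ u @ x) @ inv_word x)"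
    using assms w by (intro pres_eq_context) (auto intro: pres_eq.sym)
  also have "pres_eq X R \<dots> (u @ x @ inv_word x)"
    using pres_eq_cancel_right[of "[]" X x "u @ x @ inv_word x" R] w by simp
  also have "pres_eq X R \<dots> u"
    using pres_eq_cancel_right[of u X x "[]" R] w by simp
  finally show ?thesis .
qed

section \<open>Conjugating the letters of a strand by a letter of an earlier strand\<close>

text \<open>How conjugation by $A_{i,j}^{\pm 1}$ changes $x_r$. Put $(a, c) = (x_i, x_j)$ for $A_{i,j}$ and
$(a, c) = (x_j^{-1}, x_i^{-1})$ for its inverse, and let $D = ac$, $C = a c a^{-1} c^{-1}$ and $E = ace$,
where $e$ is $a^{-1}$ or $c^{-1}$ respectively. The cases are $x_r$ unchanged (PR1), $D x_r D^{-1}$ (PR2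
and PR3), $C x_r C^{-1}$ (PR4), $x_r E^{-1}$ (ER1) and $E x_r C^{-1}$ (ER2). For the inverse letter $E$
equals $a$ in the group; keeping three letters makes its productions look alike for both signs.\<close>

datatype action_type = Trivial | Conj_D | Conj_C | Right_E | Left_E_right_C

definition action_type :: "nat \<Rightarrow> nat \<Rightarrow> nat \<Rightarrow> nat \<Rightarrow> action_type" where
  "action_type g i j r =
    (if r = i \<or> r = j then Conj_D
     else if r < i then if r + 1 = i \<and> odd r \<and> r < 2*g + 1 then Right_E else Trivial
     else if r < j then if r = i + 1 \<and> even r \<and> r < 2*g + 1 then Left_E_right_C else Conj_C
     else Trivial)"

definition fst_letter :: "nat \<Rightarrow> nat \<Rightarrow> nat \<Rightarrow> bool \<Rightarrow> (nat \<times> nat) letter" where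
  "fst_letter s i j b = (if b then A i s else A' j s)"
definition snd_letter :: "nat \<Rightarrow> nat \<Rightarrow> nat \<Rightarrow> bool \<Rightarrow> (nat \<times> nat) letter" where
  "snd_letter s i j b = (if b then A j s else A' i s)"

definition word_D where
  "word_D s i j b = [fst_letter s i j b, snd_letter s i j b]"
definition word_C where
  "word_C s i j b = [fst_letter s i j b, snd_letter s i j b,
     inv_letter (fst_letter s i j b), inv_letter (snd_letter s i j b)]"
definition word_E where
  "word_E s i j b = [fst_letter s i j b, snd_letter s i j b,
     inv_letter (if b then fst_letter s i j b else snd_letter s i j b)]"

lemmas action_word_defs = word_D_def word_C_def word_E_def fst_letter_def snd_letter_def

definition left_word where
  "left_word g s i j b r = (case action_type g i j r of
     Trivial \<Rightarrow> [] | Conj_D \<Rightarrow> word_D s i j b | Conj_C \<Rightarrow> word_C s i j b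
   | Right_E \<Rightarrow> [] | Left_E_right_C \<Rightarrow> word_E s i j b)"

definition right_word where
  "right_word g s i j b r = (case action_type g i j r of
     Trivial \<Rightarrow> [] | Conj_D \<Rightarrow> inv_word (word_D s i j b) | Conj_C \<Rightarrow> inv_word (word_C s i j b)
   | Right_E \<Rightarrow> inv_word (word_E s i j b) | Left_E_right_C \<Rightarrow> inv_word (word_C s i j b))"

abbreviation acted where
  "acted g s i j b r \<equiv> left_word g s i j b r @ [A r s] @ right_word g s i j b r"

abbreviation braid_eq where
  "braid_eq g p n \<equiv> pres_eq (gens g p n) (braid_rels g p n)"

lemma braid_eq_rel:
  assumes "(l, r) \<in> braid_rels g p n" "l \<in> words (gens g p n)" "r \<in> words (gens g p n)"
  shows "braid_eq g p n l r"
  using pres_eq.rel[of "[]" _ "[]" l r] assms by simp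

text \<open>The relations cover every position of $r$ relative to $i$ and $j$, and each right-hand side is already
the claimed word, except in PR2, where $x_i x_j x_i^{-1} = (x_i x_j) x_j (x_i x_j)^{-1}$.\<close>

lemma braid_eq_conj_pos:
  assumes ij: "(i, j) \<in> gens g p n" and rs: "(r, s) \<in> gens g p n" and "j < s"
  shows "braid_eq g p n [A' i j, A r s, A i j] (acted g s i j True r)"
proof -
  have odd_less_Suc: False if "odd r" "2*g \<le> r" "r < Suc (2*g)" for r g :: nat
    using that by (metis dvd_triv_left le_antisym less_Suc_eq_le)
  have isg: "(i, s) \<in> gens g p n" "(j, s) \<in> gens g p n" and "i < j" "i \<ge> 1" "r \<ge> 1"
    using assms by (auto simp: gens_def)
  note ws = ij rs isg
  consider (D) "r = i" | (D') "r = j" | (E) "r + 1 = i" "odd r" "r < 2*g"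
    | (T) "i < j \<and> j < r \<and> r < s \<or> (r + 1 < i \<and> i < j \<and> j < s) \<or>
        (i = r + 1 \<and> r + 1 < j \<and> j < s \<and> (r \<ge> 2*g \<or> even r))"
    | (EC) "r = i + 1" "r < j" "even r" "r \<le> 2*g"
    | (C) "(i + 1 < r \<and> r < j \<and> j < s) \<or> (i + 1 = r \<and> r < j \<and> j < s \<and> (r > 2*g \<or> odd r))"
  proof -
    have "r < s" using rs by (simp add: gens_def)
    show thesis
      using that \<open>i < j\<close> \<open>j < s\<close> \<open>r < s\<close> by (smt (verit) Suc_eq_plus1 Suc_leI le_eq_less_or_eq linorder_neqE_nat)
  qed
  then show ?thesis
  proof cases
    case D
    have "braid_eq g p n [A' i j, A i s, A i j] [A i s, A j s, A i s, A' j s, A' i s]"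
      using \<open>i < j\<close> \<open>j < s\<close> ws by (intro braid_eq_rel braid_rels.PR3) auto
    then show ?thesis
      using D by (simp add: left_word_def right_word_def action_type_def action_word_defs)
  next
    case D'
    have "braid_eq g p n [A' i j, A j s, A i j] [A i s, A j s, A' i s]"
      using \<open>i < j\<close> \<open>j < s\<close> ws by (intro braid_eq_rel braid_rels.PR2) auto
    also have "braid_eq g p n \<dots> [A i s, A j s, A j s, A' j s, A' i s]"
      using \<open>i < j\<close> ws by (intro pres_eq_if_freely_equal) auto
    finally show ?thesis
      using D' by (simp add: left_word_def right_word_def action_type_def action_word_defs)
  next
    case E
    have "r < i" using E by simp
    moreover have "braid_eq g p n [A' (r + 1) j, A r s, A (r + 1) j]
        [A r s, A (r + 1) s, A' j s, A' (r + 1) s]"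
      using E \<open>i < j\<close> \<open>j < s\<close> ws by (intro braid_eq_rel braid_rels.ER1) auto
    ultimately show ?thesis
      using E \<open>i < j\<close> by (auto simp: left_word_def right_word_def action_type_def action_word_defs)
  next
    case T
    have "action_type g i j r = Trivial"
      using T odd_less_Suc by (auto simp: action_type_def)
    moreover have "braid_eq g p n [A' i j, A r s, A i j] [A r s]"
      using T ws by (intro braid_eq_rel braid_rels.PR1) auto
    ultimately show ?thesis by (simp add: left_word_def right_word_def)
  next
    case EC
    have "braid_eq g p n [A' (r - 1) j, A r s, A (r - 1) j]
      [A (r - 1) s, A j s, A' (r - 1) s, A r s, A j s, A (r - 1) s, A' j s, A' (r - 1) s]"
      using EC \<open>i < j\<close> \<open>j < s\<close> ws by (intro braid_eq_rel braid_rels.ER2) auto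
    then show ?thesis
      using EC by (simp add: left_word_def right_word_def action_type_def action_word_defs)
  next
    case C
    have "action_type g i j r = Conj_C" using C by (auto simp: action_type_def)
    moreover have "braid_eq g p n [A' i j, A r s, A i j]
       [A i s, A j s, A' i s, A' j s, A r s, A j s, A i s, A' j s, A' i s]"
      using C ws by (intro braid_eq_rel braid_rels.PR4) auto
    ultimately show ?thesis
      by (simp add: left_word_def right_word_def action_word_defs)
  qed
qed

definition acted_letter where
  "acted_letter g i j l = (case l of ((r, s), b) \<Rightarrow>
     if b then acted g s i j True r else inv_word (acted g s i j True r))"

lemma braid_eq_conj_word:
  assumes ij: "(i, j) \<in> gens g p n" and "j < s" and "u \<in> words (gens g p n)" "\<forall>l\<in>set u. snd (fst l) = s"
  shows "braid_eq g p n ([A' i j] @ u @ [A i j]) (concat (map (acted_letter g i j) u))"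
  using assms(3,4)
proof (induction u rule: list.induct)
  case Nil
  show ?case using ij pres_eq_left_inverse[of "[A i j]" "gens g p n" "braid_rels g p n"] by simp
next
  case (Cons l u)
  obtain r b where l: "l = ((r, s), b)" using Cons.prems by (cases l) auto
  have rs: "(r, s) \<in> gens g p n" using Cons.prems l by simp
  have pos: "braid_eq g p n (inv_word [A i j] @ [A r s] @ [A i j]) (acted g s i j True r)"
    using braid_eq_conj_pos[OF ij rs \<open>j < s\<close>] by simp
  have "braid_eq g p n (inv_word [A i j] @ [l] @ [A i j]) (acted_letter g i j l)"
    using pos pres_eq_conj_inv[OF pos] l by (cases b) (auto simp: acted_letter_def)
  then have "braid_eq g p n (inv_word [A i j] @ ([l] @ u) @ [A i j])
     (acted_letter g i j l @ concat (map (acted_letter g i j) u))"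
    using Cons ij by (intro pres_eq_conj_append) auto
  then show ?case by simp
qed

text \<open>Since the letters are those of a group, it suffices to conjugate the claimed word by $A_{i,j}$ and to
find $x_r$. The conjugation is letterwise and known for $A_{i,j}$, and the result reduces freely to $x_r$
in each of the five cases.\<close>

lemma braid_eq_conj_neg:
  assumes ij: "(i, j) \<in> gens g p n" and rs: "(r, s) \<in> gens g p n" and "j < s"
  shows "braid_eq g p n [A i j, A r s, A' i j] (acted g s i j False r)"
proof -
  have isg: "(i, s) \<in> gens g p n" "(j, s) \<in> gens g p n" and "i < j"
    using assms by (auto simp: gens_def)
  let ?u = "acted g s i j False r"
  have u: "?u \<in> words (gens g p n)" "\<forall>l\<in>set ?u. snd (fst l) = s"
    using isg rs by (auto simp: left_word_def right_word_def action_word_defs split: action_type.split)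
  have "freely_reduce (concat (map (acted_letter g i j) ?u)) = freely_reduce [A r s]"
  proof -
    have ai: "action_type g i j i = Conj_D" and aj: "action_type g i j j = Conj_D"
      by (auto simp: action_type_def)
    have rij: "action_type g i j r = Conj_D \<longleftrightarrow> r = i \<or> r = j" by (auto simp: action_type_def)
    note defs = left_word_def right_word_def acted_letter_def action_word_defs ai aj
    show ?thesis
      using rij \<open>i < j\<close> by (cases "action_type g i j r") (auto simp: defs)
  qed
  note reduced = this
  have conj: "braid_eq g p n (inv_word [A i j] @ ?u @ [A i j])
      (concat (map (acted_letter g i j) ?u))"
    using braid_eq_conj_word[OF ij \<open>j < s\<close> u] by simp
  have "concat (map (acted_letter g i j) ?u) \<in> words (gens g p n)" "[A r s] \<in> words (gens g p n)"
    using pres_eq_words[OF conj] rs by simp_all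
  from pres_eq.trans[OF conj pres_eq_if_freely_equal[OF this reduced]]
  have "braid_eq g p n (inv_word [A i j] @ ?u @ [A i j]) [A r s]" .
  from pres_eq_conj_flip[OF this] show ?thesis by simp
qed

lemma braid_eq_conj:
  assumes "(i, j) \<in> gens g p n" "(r, s) \<in> gens g p n" "j < s"
  shows "braid_eq g p n [((i, j), \<not> b), A r s, ((i, j), b)] (acted g s i j b r)"
  using braid_eq_conj_pos[OF assms] braid_eq_conj_neg[OF assms] by (cases b) auto

section \<open>The factors of the combed normal form\<close>

definition upto_strand :: "nat \<Rightarrow> (nat \<times> nat) letter list \<Rightarrow> (nat \<times> nat) letter list" where
  "upto_strand J u = filter (\<lambda>l. snd (fst l) \<le> J) u"

lemma upto_strand_simps [simp]:
  "upto_strand J [] = []"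
  "upto_strand J (l # u) = (if snd (fst l) \<le> J then l # upto_strand J u else upto_strand J u)"
  "upto_strand J (u @ v) = upto_strand J u @ upto_strand J v"
  by (simp_all add: upto_strand_def)

lemma set_upto_strand [simp]: "set (upto_strand J u) = {l \<in> set u. snd (fst l) \<le> J}"
  by (auto simp: upto_strand_def)

lemma upto_strand_in_words [simp]: "u \<in> words X \<Longrightarrow> upto_strand J u \<in> words X"
  by (auto simp: upto_strand_def)

text \<open>The common shape of the relations on which the projections to fewer strands rest.\<close>

lemma braid_rels_shape:
  assumes "(l, r) \<in> braid_rels g p n"
  obtains i j x s where "l = [A' i j, A x s, A i j]" "j < s" "(i, j) \<in> gens g p n"
    "\<forall>y\<in>set r. snd (fst y) = s"
  using assms by (cases rule: braid_rels.cases) (auto intro!: that)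

text \<open>Forgetting the strands after $J$: a relation for strand $s$ survives if $s \le J$; otherwise its right-hand
side disappears, and its left-hand side becomes empty or $A_{i,j}^{-1} A_{i,j}$.\<close>

lemma braid_eq_upto_strand:
  "braid_eq g p n u v \<Longrightarrow> braid_eq g p n (upto_strand J u) (upto_strand J v)"
proof (induction rule: pres_eq.induct)
  case (refl u)
  then show ?case by (intro pres_eq.refl upto_strand_in_words)
next
  case (sym u v)
  then show ?case by (blast intro: pres_eq.sym)
next
  case (trans u v w)
  then show ?case by (blast intro: pres_eq.trans)
next
  case (cancel u v x b)
  then show ?case
    using pres_eq.cancel[of "upto_strand J u" "gens g p n" "upto_strand J v" x "braid_rels g p n" b]
      pres_eq.refl[of "upto_strand J u @ upto_strand J v" "gens g p n"] by simp
next
  case (rel u v l r)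
  from rel.hyps(3) obtain i j x s where l: "l = [A' i j, A x s, A i j]" "j < s"
    "(i, j) \<in> gens g p n" and r: "\<forall>y\<in>set r. snd (fst y) = s"
    by (rule braid_rels_shape)
  have "braid_eq g p n (upto_strand J l) (upto_strand J r)"
  proof (cases "s \<le> J")
    case True
    then have "upto_strand J l = l" "upto_strand J r = r"
      using l r by (auto simp: upto_strand_def)
    then show ?thesis using rel braid_eq_rel by metis
  next
    case False
    then have "upto_strand J r = []" using r by (auto simp: upto_strand_def)
    moreover have "upto_strand J l = (if j \<le> J then inv_word [A i j] @ [A i j] else [])"
      using l False by simp
    ultimately show ?thesis
      using l pres_eq_left_inverse[of "[A i j]" "gens g p n"] by (auto intro: pres_eq.refl)
  qed
  then show ?case using rel by (auto intro!: pres_eq_context)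
qed

abbreviation strand_letters :: "nat \<Rightarrow> (nat \<times> nat) letter set" where
  "strand_letters s \<equiv> {((i, s), b) | i b. 1 \<le> i \<and> i < s}"

text \<open>The word $w_{k-1}^{-1} w_k$ for the $k$-th factor.\<close>

definition factor_word where
  "factor_word g p k w =
     inv_word (upto_strand (strand_index g p (k - 1)) w) @ upto_strand (strand_index g p k) w"

lemma strand_words_in_words:
  assumes "p > 0" "1 \<le> k" "k \<le> n" "u \<in> lists (strand_letters (strand_index g p k))"
  shows "u \<in> words (gens g p n)"
proof -
  have "strand_letters (strand_index g p k) \<subseteq> gens g p n \<times> UNIV"
    using assms by (auto simp: gens_def strand_index_def)
  from lists_mono[OF this] assms(4) show ?thesis by (rule subsetD)
qed

lemma braid_mult:
  "u \<in> words (gens g p n) \<Longrightarrow> v \<in> words (gens g p n) \<Longrightarrow>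
   braid g p n u \<otimes>\<^bsub>pure_braid_group g p n\<^esub> braid g p n v = braid g p n (u @ v)"
  by (simp add: braid_def pure_braid_group_def pres_class_mult)

lemma braid_one: "\<one>\<^bsub>pure_braid_group g p n\<^esub> = braid g p n []"
  by (simp add: braid_def pure_braid_group_def presented_group_def)

lemma braid_eq_iff:
  "u \<in> words (gens g p n) \<Longrightarrow> braid g p n u = braid g p n v \<longleftrightarrow> braid_eq g p n u v"
  by (simp add: braid_def pres_class_eq_iff)

lemma group_pure_braid_group: "group (pure_braid_group g p n)"
  by (simp add: pure_braid_group_def group_presented_group)

lemma braid_in_carrier:
  "u \<in> words (gens g p n) \<Longrightarrow> braid g p n u \<in> carrier (pure_braid_group g p n)"
  by (simp add: braid_def pure_braid_group_def presented_group_def)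

lemma braid_inv:
  assumes "u \<in> words (gens g p n)"
  shows "inv\<^bsub>pure_braid_group g p n\<^esub> braid g p n u = braid g p n (inv_word u)"
  using assms
  by (intro group.inv_equality[OF group_pure_braid_group])
    (auto simp: braid_mult braid_one braid_in_carrier braid_eq_iff pres_eq_left_inverse)

lemma strand_subgroup_eq:
  assumes "p > 0" "1 \<le> k" "k \<le> n"
  shows "strand_subgroup g p n k = braid g p n ` lists (strand_letters (strand_index g p k))"
    (is "_ = _ ` lists ?F")
proof (intro equalityI subsetI)
  note ws = strand_words_in_words[OF assms]
  let ?s = "strand_index g p k"
  fix U assume "U \<in> strand_subgroup g p n k"
  then have "U \<in> generate (pure_braid_group g p n) {braid g p n [A i ?s] | i. 1 \<le> i \<and> i < ?s}"
    by (simp add: strand_subgroup_def)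
  then show "U \<in> braid g p n ` lists ?F"
  proof induction
    case one
    then show ?case by (auto simp: braid_one)
  next
    case (incl h)
    then obtain i where "h = braid g p n [A i ?s]" "1 \<le> i" "i < ?s" by auto
    then show ?case by (intro image_eqI[of _ _ "[A i ?s]"]) auto
  next
    case (inv h)
    then obtain i where i: "h = braid g p n [A i ?s]" "1 \<le> i" "i < ?s" by auto
    then have "[A i ?s] \<in> words (gens g p n)" by (intro ws) auto
    then have "inv\<^bsub>pure_braid_group g p n\<^esub> h = braid g p n (inv_word [A i ?s])"
      unfolding i by (rule braid_inv)
    then show ?case using i by (intro image_eqI[of _ _ "inv_word [A i ?s]"]) auto
  next
    case (eng h1 h2)
    then obtain u v where "h1 = braid g p n u" "h2 = braid g p n v" "u \<in> lists ?F" "v \<in> lists ?F"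
      by auto
    then show ?case
      using ws by (intro image_eqI[of _ _ "u @ v"]) (auto simp: braid_mult)
  qed
next
  note ws = strand_words_in_words[OF assms]
  let ?s = "strand_index g p k"
  fix U assume "U \<in> braid g p n ` lists ?F"
  then obtain u where u: "U = braid g p n u" "u \<in> lists ?F" by auto
  from u(2) have "braid g p n u \<in> generate (pure_braid_group g p n) {braid g p n [A i ?s] | i. 1 \<le> i \<and> i < ?s}"
    (is "_ \<in> generate _ ?H")
  proof (induction u rule: list.induct)
    case Nil
    then show ?case by (simp add: generate.one flip: braid_one)
  next
    case (Cons l u)
    then obtain i b where l: "l = ((i, ?s), b)" "1 \<le> i" "i < ?s" by auto
    have w: "[A i ?s] \<in> words (gens g p n)" "[l] \<in> words (gens g p n)" "u \<in> words (gens g p n)"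
      using l Cons.prems by (intro ws; auto)+
    have h: "braid g p n [A i ?s] \<in> ?H" using l by auto
    have "braid g p n [l] \<in> generate (pure_braid_group g p n) ?H"
    proof (cases b)
      case True
      then show ?thesis using generate.incl[OF h] l by simp
    next
      case False
      then show ?thesis using generate.inv[OF h, of "pure_braid_group g p n"] l braid_inv[OF w(1)] by simp
    qed
    then have "braid g p n [l] \<otimes>\<^bsub>pure_braid_group g p n\<^esub> braid g p n u
        \<in> generate (pure_braid_group g p n) ?H"
      using Cons by (intro generate.eng) auto
    then show ?case using w by (simp add: braid_mult)
  qed
  then show "U \<in> strand_subgroup g p n k" using u by (simp add: strand_subgroup_def)
qed

lemma concat_in_lists: "set us \<subseteq> lists Y \<Longrightarrow> concat us \<in> lists Y"
  by (induction us) auto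

lemma foldr_mult_braid:
  "set us \<subseteq> words (gens g p n) \<Longrightarrow>
    foldr (\<lambda>x y. x \<otimes>\<^bsub>pure_braid_group g p n\<^esub> y) (map (braid g p n) us) \<one>\<^bsub>pure_braid_group g p n\<^esub>
      = braid g p n (concat us)"
proof (induction us)
  case (Cons u us)
  then have "u \<in> words (gens g p n)" "concat us \<in> words (gens g p n)"
    using concat_in_lists[of us] by auto
  then show ?case using Cons by (simp add: braid_mult)
qed (simp add: braid_one)

lemma upto_strand_concat:
  assumes "\<And>k. k < length us \<Longrightarrow> us ! k \<in> lists (strand_letters (strand_index g p (Suc k)))"
  shows "upto_strand (strand_index g p k) (concat us) = concat (take k us)"
  using assms
proof (induction us rule: rev_induct)
  case (snoc u us)
  have IH: "upto_strand (strand_index g p k) (concat us) = concat (take k us)"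
  proof (rule snoc.IH)
    fix k assume "k < length us"
    then show "us ! k \<in> lists (strand_letters (strand_index g p (Suc k)))"
      using snoc.prems[of k] by (simp add: nth_append)
  qed
  have "u \<in> lists (strand_letters (strand_index g p (Suc (length us))))"
    using snoc.prems[of "length us"] by simp
  then have "\<forall>l\<in>set u. snd (fst l) = strand_index g p (Suc (length us))" by auto
  then have "upto_strand (strand_index g p k) u = (if Suc (length us) \<le> k then u else [])"
    by (auto simp: upto_strand_def strand_index_def)
  then show ?case using IH by auto
qed simp

text \<open>If $\alpha = \alpha_1 \cdots \alpha_n$, forgetting the strands after the $k$-th one shows that $w_k$
represents $\alpha_1 \cdots \alpha_k$. Dividing these equations for $k$ and $k - 1$ gives $\alpha_k$.\<close>

lemma combed_factors_unique:
  assumes p: "p > 0" and w: "w \<in> words (gens g p n)"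
    and comb: "is_combed g p n (braid g p n w) \<alpha>s"
  shows "\<alpha>s = map (\<lambda>k. braid g p n (factor_word g p (Suc k) w)) [0..<n]"
proof (rule nth_equalityI)
  have len: "length \<alpha>s = n" using comb by (simp add: is_combed_def)
  then show "length \<alpha>s = length (map (\<lambda>k. braid g p n (factor_word g p (Suc k) w)) [0..<n])"
    by simp
  have "\<exists>u. u \<in> lists (strand_letters (strand_index g p (Suc k))) \<and> \<alpha>s ! k = braid g p n u"
    if "k < n" for k
  proof -
    have "\<alpha>s ! (Suc k - 1) \<in> strand_subgroup g p n (Suc k)"
      using comb that unfolding is_combed_def by (metis One_nat_def Suc_le_eq atLeastAtMost_iff le_add1 plus_1_eq_Suc)
    then show ?thesis using strand_subgroup_eq[OF p, of "Suc k" n g] that by auto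
  qed
  then have "\<forall>k. \<exists>u. k < n \<longrightarrow>
      u \<in> lists (strand_letters (strand_index g p (Suc k))) \<and> \<alpha>s ! k = braid g p n u" by blast
  from choice[OF this] obtain \<upsilon> where "\<forall>k. k < n \<longrightarrow>
      \<upsilon> k \<in> lists (strand_letters (strand_index g p (Suc k))) \<and> \<alpha>s ! k = braid g p n (\<upsilon> k)" ..
  then have \<upsilon>: "\<And>k. k < n \<Longrightarrow> \<upsilon> k \<in> lists (strand_letters (strand_index g p (Suc k)))"
    "\<And>k. k < n \<Longrightarrow> \<alpha>s ! k = braid g p n (\<upsilon> k)" by simp_all
  define us where "us = map \<upsilon> [0..<n]"
  have us: "\<And>k. k < length us \<Longrightarrow> us ! k \<in> lists (strand_letters (strand_index g p (Suc k)))"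
    and len_us: "length us = n" using \<upsilon> by (auto simp: us_def)
  have us_words: "set us \<subseteq> words (gens g p n)"
  proof
    fix u assume "u \<in> set us"
    then obtain k where "k < n" "u = \<upsilon> k" by (auto simp: us_def)
    then show "u \<in> words (gens g p n)"
      using strand_words_in_words[OF p _ _ \<upsilon>(1), of k n] by simp
  qed
  have "\<alpha>s = map (braid g p n) us"
    using len \<upsilon> by (intro nth_equalityI) (auto simp: us_def)
  then have "braid g p n (concat us) = braid g p n w"
    using comb foldr_mult_braid[OF us_words] by (simp add: is_combed_def)
  moreover have "concat us \<in> words (gens g p n)" by (rule concat_in_lists[OF us_words])
  ultimately have eq: "braid_eq g p n (concat us) w" by (simp add: braid_eq_iff)
  fix k assume "k < length \<alpha>s"
  then have k: "k < n" using len by simp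
  have part: "braid_eq g p n (concat (take k us)) (upto_strand (strand_index g p k) w)" for k
    using braid_eq_upto_strand[OF eq, of "strand_index g p k"] upto_strand_concat[OF us] by simp
  have cw: "concat (take k us) \<in> words (gens g p n)" "us ! k \<in> words (gens g p n)"
    using us_words k len_us concat_in_lists[of "take k us"] set_take_subset[of k us] nth_mem[of k us]
    by blast+
  have "concat (take (Suc k) us) = concat (take k us) @ us ! k"
    using k len_us by (simp add: take_Suc_conv_app_nth)
  then have "braid_eq g p n (inv_word (concat (take k us)) @ concat (take k us) @ us ! k)
      (factor_word g p (Suc k) w)"
    using part[of "Suc k"] part[of k] by (auto simp: factor_word_def intro!: pres_eq_append pres_eq_inv_word)
  moreover have "braid_eq g p n (inv_word (concat (take k us)) @ concat (take k us) @ us ! k) (us ! k)"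
    using pres_eq_cancel_left[of "[]" "gens g p n" "concat (take k us)" "us ! k"] cw by simp
  ultimately have "braid_eq g p n (us ! k) (factor_word g p (Suc k) w)"
    by (blast intro: pres_eq.sym pres_eq.trans)
  then show "\<alpha>s ! k = map (\<lambda>k. braid g p n (factor_word g p (Suc k) w)) [0..<n] ! k"
    using k cw \<upsilon>(2) by (simp add: us_def braid_eq_iff)
qed

text \<open>The product of the words $w_{k-1}^{-1} w_k$ telescopes to $w_n = w$, and $w_0$ is empty because the letters
start with strand $2g+p$. What has to be supplied is that each of them is a product of letters of its strand.\<close>

lemma is_combed_factor_words:
  assumes p: "p > 0" and w: "w \<in> words (gens g p n)"
    and strand: "\<And>k. 1 \<le> k \<Longrightarrow> k \<le> n \<Longrightarrow>
      \<exists>u\<in>lists (strand_letters (strand_index g p k)). braid_eq g p n u (factor_word g p k w)"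
  shows "is_combed g p n (braid g p n w) (map (\<lambda>k. braid g p n (factor_word g p (Suc k) w)) [0..<n])"
proof -
  have fw: "factor_word g p k w \<in> words (gens g p n)" for k
    using w by (simp add: factor_word_def)
  have in_subgroup: "braid g p n (factor_word g p (Suc k) w) \<in> strand_subgroup g p n (Suc k)"
    if "k < n" for k
  proof -
    have "1 \<le> Suc k" "Suc k \<le> n" using that by auto
    from strand[OF this] obtain u where u: "u \<in> lists (strand_letters (strand_index g p (Suc k)))"
      "braid_eq g p n u (factor_word g p (Suc k) w)" by blast
    then have "braid g p n (factor_word g p (Suc k) w) = braid g p n u"
      using pres_eq_words[OF u(2)] by (simp add: braid_eq_iff pres_eq.sym)
    then show ?thesis
      using u strand_subgroup_eq[OF p \<open>1 \<le> Suc k\<close> \<open>Suc k \<le> n\<close>] by auto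
  qed
  have "braid_eq g p n (concat (map (\<lambda>k. factor_word g p (Suc k) w) [0..<k]))
      (upto_strand (strand_index g p k) w)" for k
  proof (induction k)
    case 0
    have "2*g + p \<le> snd (fst l)" if "l \<in> set w" for l
      using w that by (force simp: gens_def)
    then have "upto_strand (strand_index g p 0) w = []"
      using p by (force simp: upto_strand_def strand_index_def filter_empty_conv)
    then show ?case by (simp add: pres_eq.refl)
  next
    case (Suc k)
    then have "braid_eq g p n (concat (map (\<lambda>k. factor_word g p (Suc k) w) [0..<Suc k]))
        (upto_strand (strand_index g p k) w @ factor_word g p (Suc k) w)"
      using fw by (auto intro!: pres_eq_append pres_eq.refl simp del: upt_Suc simp: upt_Suc_append)
    also have "braid_eq g p n \<dots> (upto_strand (strand_index g p (Suc k)) w)"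
      using w pres_eq_cancel_right[of "[]" "gens g p n" "upto_strand (strand_index g p k) w"]
      by (simp add: factor_word_def)
    finally show ?case .
  qed
  note product = this[of n]
  have "braid g p n (concat (map (\<lambda>k. factor_word g p (Suc k) w) [0..<n])) =
      braid g p n (upto_strand (strand_index g p n) w)"
    using product pres_eq_words[OF product] by (simp only: braid_eq_iff)
  moreover have "upto_strand (strand_index g p n) w = w"
    using w p by (force simp: upto_strand_def gens_def strand_index_def filter_id_conv)
  ultimately have "foldr (\<lambda>x y. x \<otimes>\<^bsub>pure_braid_group g p n\<^esub> y)
      (map (\<lambda>k. braid g p n (factor_word g p (Suc k) w)) [0..<n]) \<one>\<^bsub>pure_braid_group g p n\<^esub>
      = braid g p n w"
    using foldr_mult_braid[of "map (\<lambda>k. factor_word g p (Suc k) w) [0..<n]" g p n] fw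
    by (simp add: comp_def image_subset_iff)
  moreover have "map (\<lambda>k. braid g p n (factor_word g p (Suc k) w)) [0..<n] ! (k - 1)
      \<in> strand_subgroup g p n k" if "k \<in> {1..n}" for k
    using that in_subgroup[of "k - 1"] by (cases k) (simp_all del: upt_Suc)
  ultimately show ?thesis by (simp add: is_combed_def)
qed

lemma combed_factor_eq:
  assumes "p > 0" "w \<in> words (gens g p n)" "1 \<le> k" "k \<le> n"
    and "\<And>k. 1 \<le> k \<Longrightarrow> k \<le> n \<Longrightarrow>
      \<exists>u\<in>lists (strand_letters (strand_index g p k)). braid_eq g p n u (factor_word g p k w)"
  shows "combed_factor g p n k (braid g p n w) = braid g p n (factor_word g p k w)"
proof -
  have "(THE \<alpha>s. is_combed g p n (braid g p n w) \<alpha>s) =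
      map (\<lambda>k. braid g p n (factor_word g p (Suc k) w)) [0..<n]"
    by (rule the_equality)
      (rule is_combed_factor_words[OF assms(1,2,5)], assumption+, rule combed_factors_unique[OF assms(1,2)])
  then show ?thesis using assms(3,4) by (cases k) (simp_all add: combed_factor_def)
qed

section \<open>Values of the nonterminals of a compressed word\<close>

definition sym_value :: "'f list list \<Rightarrow> 'f sym \<Rightarrow> 'f list" where
  "sym_value vs x = (case x of Term a \<Rightarrow> [a] | NonTerm q \<Rightarrow> vs ! (q - 1))"

lemma sym_value_simps [simp]:
  "sym_value vs (Term a) = [a]" "sym_value vs (NonTerm q) = vs ! (q - 1)"
  by (simp_all add: sym_value_def)

text \<open>The values are computed from the first production on, each from the values before it, so that they do
not change when productions are appended.\<close>

definition nonterm_values :: "'f compressed \<Rightarrow> 'f list list" where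
  "nonterm_values Ws = foldl (\<lambda>vs W. vs @ [concat (map (sym_value vs) W)]) [] Ws"

lemma values_simps [simp]:
  "nonterm_values [] = []"
  "nonterm_values (Ws @ [W]) = nonterm_values Ws @ [concat (map (sym_value (nonterm_values Ws)) W)]"
  by (simp_all add: nonterm_values_def)

lemma length_values [simp]: "length (nonterm_values Ws) = length Ws"
  by (induction Ws rule: rev_induct) auto

lemma nth_values_append: "q < length Ws \<Longrightarrow> nonterm_values (Ws @ Vs) ! q = nonterm_values Ws ! q"
proof (induction Vs rule: rev_induct)
  case (snoc V Vs)
  then show ?case
    using values_simps(2)[of "Ws @ Vs" V] by (simp add: nth_append del: values_simps)
qed simp

definition syms_below :: "'f set \<Rightarrow> nat \<Rightarrow> 'f sym list \<Rightarrow> bool" where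
  "syms_below F N W \<longleftrightarrow>
     (\<forall>x\<in>set W. case x of Term a \<Rightarrow> a \<in> F | NonTerm j \<Rightarrow> 1 \<le> j \<and> j \<le> N)"

lemma compressed_word_iff:
  "compressed_word F Ws \<longleftrightarrow> finite F \<and> Ws \<noteq> [] \<and> (\<forall>i<length Ws. syms_below F i (Ws ! i))"
  unfolding compressed_word_def syms_below_def
  by (auto simp: Ball_def less_Suc_eq_le Suc_le_eq gr0_conv_Suc split: sym.splits)

lemma compressed_word_snoc:
  "Ws \<noteq> [] \<Longrightarrow> compressed_word F (Ws @ [W]) \<longleftrightarrow> compressed_word F Ws \<and> syms_below F (length Ws) W"
  by (auto simp: compressed_word_iff nth_append less_Suc_eq)

lemma nth_values_take:
  assumes "q < length Ws"
  shows "nonterm_values Ws ! q = concat (map (sym_value (nonterm_values (take q Ws))) (Ws ! q))"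
proof -
  have "nonterm_values Ws ! q = nonterm_values (take (Suc q) Ws @ drop (Suc q) Ws) ! q" by simp
  also have "\<dots> = nonterm_values (take (Suc q) Ws) ! q"
    using assms by (intro nth_values_append) simp
  also have "take (Suc q) Ws = take q Ws @ [Ws ! q]"
    using assms by (rule take_Suc_conv_app_nth)
  finally show ?thesis using assms by (simp add: nth_append)
qed

lemma concat_values_in_lists:
  assumes "compressed_word F Ws" "q < length Ws"
  shows "nonterm_values Ws ! q \<in> lists F"
  using assms(2)
proof (induction q rule: less_induct)
  case (less q)
  have v: "nonterm_values Ws ! q = concat (map (sym_value (nonterm_values (take q Ws))) (Ws ! q))"
    by (rule nth_values_take[OF less.prems])
  have "sym_value (nonterm_values (take q Ws)) x \<in> lists F" if x: "x \<in> set (Ws ! q)" for x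
  proof (cases x)
    case (Term a)
    then show ?thesis using assms(1) less.prems x by (force simp: compressed_word_iff syms_below_def)
  next
    case (NonTerm j)
    then have "1 \<le> j" "j \<le> q"
      using assms(1) less.prems x by (force simp: compressed_word_iff syms_below_def)+
    then have "nonterm_values (take q Ws) ! (j - 1) = nonterm_values Ws ! (j - 1)"
      using less.prems nth_values_append[of "j - 1" "take q Ws" "drop q Ws"] by simp
    then show ?thesis using NonTerm less.IH[of "j - 1"] less.prems \<open>1 \<le> j\<close> \<open>j \<le> q\<close> by simp
  qed
  then show ?case unfolding v by (intro concat_in_lists) auto
qed

lemma nth_values:
  assumes "compressed_word F Ws" "q < length Ws"
  shows "nonterm_values Ws ! q = concat (map (sym_value (nonterm_values Ws)) (Ws ! q))"
proof -
  have v: "nonterm_values Ws ! q = concat (map (sym_value (nonterm_values (take q Ws))) (Ws ! q))"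
    by (rule nth_values_take[OF assms(2)])
  have "sym_value (nonterm_values (take q Ws)) x = sym_value (nonterm_values Ws) x" if x: "x \<in> set (Ws ! q)" for x
  proof (cases x)
    case (NonTerm j)
    then have "1 \<le> j" "j \<le> q"
      using assms x by (force simp: compressed_word_iff syms_below_def)+
    then show ?thesis
      using NonTerm assms nth_values_append[of "j - 1" "take q Ws" "drop q Ws"] by simp
  qed simp
  then show ?thesis unfolding v by (simp cong: map_cong)
qed

text \<open>Replacing the greatest nonterminal by its production does not change the value of a word; after all
replacements only terminals are left, which are their own value.\<close>

lemma expand_value:
  assumes "compressed_word F Ws" "N \<le> length Ws" "syms_below F N u"
  shows "concat (map (case_sym (\<lambda>a. [a]) (\<lambda>_. [])) (expand Ws N u)) =
    concat (map (sym_value (nonterm_values Ws)) u)"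
  using assms(2,3)
proof (induction N arbitrary: u)
  case 0
  then show ?case
    by (auto simp: syms_below_def split: sym.splits intro!: arg_cong[of _ _ concat])
next
  case (Suc N)
  let ?u = "replace_nonterm (Suc N) (Ws ! N) u"
  have "syms_below F N (Ws ! N)" using assms(1) Suc.prems by (simp add: compressed_word_iff)
  then have "syms_below F N ?u"
    using Suc.prems(2) unfolding syms_below_def replace_nonterm_def
    by (auto split: sym.splits if_splits)
  moreover have "concat (map (sym_value (nonterm_values Ws)) ?u) = concat (map (sym_value (nonterm_values Ws)) u)"
    using nth_values[OF assms(1), of N] Suc.prems(1)
    by (induction u) (auto simp: replace_nonterm_def)
  ultimately show ?case using Suc by simp
qed

lemma ev_eq_last_value:
  assumes "compressed_word F Ws"
  shows "ev Ws = nonterm_values Ws ! (length Ws - 1)"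
proof -
  have "length Ws > 0" using assms by (simp add: compressed_word_def)
  then have "syms_below F (length Ws) [NonTerm (length Ws)]" by (simp add: syms_below_def Suc_le_eq)
  from expand_value[OF assms order.refl this] show ?thesis by (simp add: ev_def)
qed

section \<open>Compressed words that follow the conjugation by a suffix\<close>

text \<open>The number \<open>q\<close> denotes a nonterminal whose value is the word \<open>u\<close> conjugated by \<open>\<beta>\<close>. Separating
\<open>\<beta>\<close> from \<open>u\<close> makes productions multiplicative in \<open>u\<close>.\<close>

definition represents ::
  "'a set \<Rightarrow> ('a letter list \<times> 'a letter list) set \<Rightarrow> 'a letter list \<Rightarrow> 'a letter compressed \<Rightarrow> nat
    \<Rightarrow> 'a letter list \<Rightarrow> bool" where
  "represents X R \<beta> Ws q u \<longleftrightarrow> 1 \<le> q \<and> q \<le> length Ws \<and> \<beta> \<in> words X \<and> u \<in> words X \<and>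
     pres_eq X R (nonterm_values Ws ! (q - 1)) (inv_word \<beta> @ u @ \<beta>)"

lemma represents_append: "represents X R \<beta> Ws q u \<Longrightarrow> represents X R \<beta> (Ws @ Vs) q u"
  by (auto simp: represents_def nth_values_append)

lemma represents_production:
  assumes "list_all2 (represents X R \<beta> Ws) qs us" "\<beta> \<in> words X"
  shows "represents X R \<beta> (Ws @ [map NonTerm qs]) (Suc (length Ws)) (concat us)"
proof -
  have "concat us \<in> words X \<and>
      pres_eq X R (concat (map (\<lambda>q. nonterm_values Ws ! (q - 1)) qs)) (inv_word \<beta> @ concat us @ \<beta>)"
    using assms(1)
  proof (induction rule: list_all2_induct)
    case Nil
    then show ?case using pres_eq_left_inverse[OF assms(2)] by (auto intro: pres_eq.sym)
  next
    case (Cons q qs u us)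
    then have w: "u \<in> words X" "concat us \<in> words X" by (auto simp: represents_def)
    have "pres_eq X R (concat (map (\<lambda>q. nonterm_values Ws ! (q - 1)) (q # qs)))
        ((inv_word \<beta> @ u @ \<beta>) @ (inv_word \<beta> @ concat us @ \<beta>))"
      using Cons pres_eq_append[of X R "nonterm_values Ws ! (q - 1)" "inv_word \<beta> @ u @ \<beta>"]
      by (simp add: represents_def)
    also have "pres_eq X R \<dots> (inv_word \<beta> @ concat (u # us) @ \<beta>)"
      using pres_eq_cancel_right[of "inv_word \<beta> @ u" X \<beta> "concat us @ \<beta>" R] w assms(2) by simp
    finally show ?case using w by simp
  qed
  then show ?thesis
    using assms(2) by (simp add: represents_def nth_append comp_def)
qed

lemma compressed_word_nonterms:
  assumes "compressed_word F Ws" "\<forall>q\<in>set qs. 1 \<le> q \<and> q \<le> length Ws"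
  shows "compressed_word F (Ws @ [map NonTerm qs])"
proof -
  have "Ws \<noteq> []" using assms by (simp add: compressed_word_def)
  then show ?thesis using assms by (auto simp: compressed_word_snoc syms_below_def)
qed

lemma represents_productions:
  assumes cw: "compressed_word F Ws" and \<beta>: "\<beta> \<in> words X"
    and "list_all2 (list_all2 (represents X R \<beta> Ws)) qss uss"
  shows "compressed_word F (Ws @ map (map NonTerm) qss) \<and>
    (\<forall>k<length uss. represents X R \<beta> (Ws @ map (map NonTerm) qss) (length Ws + k + 1) (concat (uss ! k)))"
  using assms(3)
proof (induction qss arbitrary: uss rule: rev_induct)
  case Nil
  then show ?case using cw by simp
next
  case (snoc qs qss)
  then obtain uss' us where uss: "uss = uss' @ [us]" and
    uss': "list_all2 (list_all2 (represents X R \<beta> Ws)) qss uss'" and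
    us: "list_all2 (represents X R \<beta> Ws) qs us"
    by (auto simp: list_all2_append1 list_all2_Cons1)
  let ?Vs = "Ws @ map (map NonTerm) qss"
  note IH = snoc.IH[OF uss']
  have "\<forall>q\<in>set qs. 1 \<le> q \<and> q \<le> length ?Vs"
    using us by induction (auto simp: represents_def)
  with IH have "compressed_word F (?Vs @ [map NonTerm qs])"
    by (intro compressed_word_nonterms) simp_all
  moreover have "represents X R \<beta> (?Vs @ [map NonTerm qs]) (Suc (length ?Vs)) (concat us)"
    by (intro represents_production \<beta> list_all2_mono[OF us] represents_append)
  moreover have "length uss' = length qss" using uss' by (simp add: list_all2_lengthD)
  ultimately show ?case
    using IH uss represents_append[of X R \<beta> ?Vs _ _ "[map NonTerm qs]"]
    by (auto simp: nth_append less_Suc_eq)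
qed

lemma represents_empty_production:
  assumes "Ws \<noteq> []" "Ws ! 0 = []" "\<beta> \<in> words X"
  shows "represents X R \<beta> Ws 1 []"
proof -
  have "nonterm_values Ws ! 0 = []" using assms nth_values_take[of 0 Ws] by simp
  then show ?thesis
    using assms pres_eq_left_inverse[of \<beta> X R] by (auto simp: represents_def Suc_le_eq intro: pres_eq.sym)
qed

text \<open>The step from $\beta$ to $x \beta$: whatever represents $x^{-1} u x$ with respect to $\beta$ represents
$u$ with respect to $x \beta$, so that only $x^{-1} u x$ has to be expressed by known symbols.\<close>

lemma represents_conjugate:
  assumes "represents X R \<beta> Ws q u'" "pres_eq X R (inv_word x @ u @ x) u'" "u \<in> words X" "x \<in> words X"
  shows "represents X R (x @ \<beta>) Ws q u"
proof -
  have b: "\<beta> \<in> words X" using assms by (simp add: represents_def)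
  have "pres_eq X R (nonterm_values Ws ! (q - 1)) (inv_word \<beta> @ u' @ \<beta>)"
    using assms by (simp add: represents_def)
  also have "pres_eq X R \<dots> (inv_word \<beta> @ (inv_word x @ u @ x) @ \<beta>)"
    using assms(2) b by (intro pres_eq_context) (auto intro: pres_eq.sym)
  finally show ?thesis using assms by (simp add: represents_def)
qed

abbreviation braid_represents where
  "braid_represents g p n \<equiv> represents (gens g p n) (braid_rels g p n)"

text \<open>The invariant of the algorithm after the suffix \<open>v\<close> has been read, where \<open>f r\<close> and \<open>Suc (f r)\<close> are
the nonterminals for $x_r$ and $x_r^{-1}$. The first production is empty and serves as the trivial word.
The last nonterminal has the value $\beta^{-1} v'$, with $v'$ the part of \<open>v\<close> on the strands up to
\<open>s\<close>; in terms of \<open>represents\<close> it stands for $v' \beta^{-1}$.\<close>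

definition tracks ::
  "nat \<Rightarrow> nat \<Rightarrow> nat \<Rightarrow> nat \<Rightarrow> (nat \<times> nat) letter list \<Rightarrow> (nat \<times> nat) letter compressed
    \<Rightarrow> (nat \<Rightarrow> nat) \<Rightarrow> bool" where
  "tracks g p n s v Ws f \<longleftrightarrow>
     compressed_word (strand_letters s) Ws \<and> Ws ! 0 = [] \<and>
     (\<forall>r. 1 \<le> r \<and> r < s \<longrightarrow>
        braid_represents g p n (upto_strand (s - 1) v) Ws (f r) [A r s] \<and>
        braid_represents g p n (upto_strand (s - 1) v) Ws (Suc (f r)) [A' r s]) \<and>
     braid_represents g p n (upto_strand (s - 1) v) Ws (length Ws)
       (upto_strand s v @ inv_word (upto_strand (s - 1) v))"

definition init_productions :: "nat \<Rightarrow> nat \<Rightarrow> (nat \<times> nat) letter compressed" where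
  "init_productions s r = [] # concat (map (\<lambda>r. [[Term (A r s)], [Term (A' r s)]]) [1..<r])"

lemma finite_strand_letters: "finite (strand_letters s)"
proof (rule finite_subset)
  show "strand_letters s \<subseteq> ({..<s} \<times> {s}) \<times> UNIV" by auto
qed simp

lemma init_productions_Suc:
  "1 \<le> r \<Longrightarrow> init_productions s (Suc r) = init_productions s r @ [[Term (A r s)], [Term (A' r s)]]"
  by (simp add: init_productions_def)

lemma length_init_productions: "1 \<le> r \<Longrightarrow> length (init_productions s r) = 2 * r - 1"
  by (induction r rule: nat_induct_at_least) (auto simp: init_productions_Suc, auto simp: init_productions_def)

text \<open>The final empty production is the first root: the root must be the last nonterminal even if no letter
of \<open>w\<close> contributes to the strand.\<close>

lemma init_tracks:
  assumes gens: "\<And>r. 1 \<le> r \<Longrightarrow> r < s \<Longrightarrow> (r, s) \<in> gens g p n" and "1 \<le> s"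
  shows "tracks g p n s [] (init_productions s s @ [[]]) (\<lambda>r. 2 * r)"
proof -
  have "compressed_word (strand_letters s) (init_productions s t) \<and>
      (\<forall>r. 1 \<le> r \<and> r < t \<longrightarrow>
        braid_represents g p n [] (init_productions s t) (2 * r) [A r s] \<and>
        braid_represents g p n [] (init_productions s t) (Suc (2 * r)) [A' r s])"
    if "1 \<le> t" "t \<le> s" for t
    using that
  proof (induction t rule: nat_induct_at_least)
    case base
    then show ?case
      using finite_strand_letters[of s]
      by (simp add: init_productions_def compressed_word_iff syms_below_def)
  next
    case (Suc t)
    let ?Ws = "init_productions s t" and ?W1 = "[Term (A t s)]" and ?W2 = "[Term (A' t s)]"
    have len: "length ?Ws = 2 * t - 1" using Suc by (simp add: length_init_productions)
    have ne: "?Ws \<noteq> []" by (simp add: init_productions_def)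
    have "compressed_word (strand_letters s) ((?Ws @ [?W1]) @ [?W2])"
      unfolding compressed_word_snoc[OF ne] using Suc ne
      by (subst compressed_word_snoc) (auto simp: compressed_word_snoc syms_below_def)
    moreover have "braid_represents g p n [] ((?Ws @ [?W1]) @ [?W2]) (2 * t) [A t s]"
      "braid_represents g p n [] ((?Ws @ [?W1]) @ [?W2]) (Suc (2 * t)) [A' t s]"
    proof -
      have "nonterm_values ((?Ws @ [?W1]) @ [?W2]) = nonterm_values ?Ws @ [[A t s], [A' t s]]"
        by (simp only: values_simps) simp
      then show "braid_represents g p n [] ((?Ws @ [?W1]) @ [?W2]) (2 * t) [A t s]"
        "braid_represents g p n [] ((?Ws @ [?W1]) @ [?W2]) (Suc (2 * t)) [A' t s]"
        using len Suc gens[of t]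
        by (auto simp: represents_def nth_append numeral_2_eq_2 intro!: pres_eq.refl)
    qed
    ultimately show ?case
      using Suc represents_append[of _ _ _ ?Ws _ _ "[?W1] @ [?W2]"]
      by (auto simp: init_productions_Suc less_Suc_eq)
  qed
  note init = this[OF \<open>1 \<le> s\<close> order.refl]
  let ?Ws = "init_productions s s"
  have "compressed_word (strand_letters s) (?Ws @ [map NonTerm []])"
    using init by (intro compressed_word_nonterms) auto
  moreover have "braid_represents g p n [] (?Ws @ [map NonTerm []]) (Suc (length ?Ws)) []"
    using represents_production[of _ _ "[]" ?Ws "[]" "[]"] by simp
  ultimately show ?thesis
    using init by (auto simp: tracks_def intro: represents_append)
       (simp_all add: init_productions_def)
qed

lemma tracks_cong:
  assumes "\<And>r. 1 \<le> r \<Longrightarrow> r < s \<Longrightarrow> f r = f' r"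
  shows "tracks g p n s v Ws f \<longleftrightarrow> tracks g p n s v Ws f'"
  using assms by (auto simp: tracks_def)

lemma tracks_skip:
  assumes "tracks g p n s v Ws f" "s < j"
  shows "tracks g p n s (((i, j), b) # v) Ws f"
proof -
  have "\<not> j \<le> s - 1" "\<not> j \<le> s" using assms(2) by simp_all
  then show ?thesis using assms(1) by (simp add: tracks_def)
qed

lemma tracks_strand_letter:
  assumes t: "tracks g p n s v Ws f" and i: "1 \<le> i" "i < s"
  shows "tracks g p n s (((i, s), b) # v)
    (Ws @ [map NonTerm [if b then f i else Suc (f i), length Ws]]) f"
proof -
  let ?\<beta> = "upto_strand (s - 1) v" and ?q = "if b then f i else Suc (f i)"
  let ?u = "upto_strand s v @ inv_word ?\<beta>"
  have R: "braid_represents g p n ?\<beta> Ws (length Ws) ?u" and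
    x: "braid_represents g p n ?\<beta> Ws ?q [((i, s), b)]"
    and cw: "compressed_word (strand_letters s) Ws"
    using t i by (simp_all add: tracks_def)
  have w: "?\<beta> \<in> words (gens g p n)" using R by (simp add: represents_def)
  have "braid_represents g p n ?\<beta> (Ws @ [map NonTerm [?q, length Ws]]) (Suc (length Ws))
     (((i, s), b) # ?u)"
    using represents_production[of _ _ ?\<beta> Ws "[?q, length Ws]" "[[((i, s), b)], ?u]"] R x w by simp
  moreover have "compressed_word (strand_letters s) (Ws @ [map NonTerm [?q, length Ws]])"
    using cw x R by (intro compressed_word_nonterms) (auto simp: represents_def)
  moreover have "\<not> s \<le> s - 1" using i by simp
  moreover have "Ws \<noteq> []" using cw by (simp add: compressed_word_def)
  ultimately show ?thesis
    using t unfolding tracks_def by (auto simp: represents_append nth_append)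
qed

text \<open>The symbols for $a, a^{-1}, c, c^{-1}, e, e^{-1}$, which depend on the sign of the letter.\<close>

definition letter_symbols :: "(nat \<Rightarrow> nat) \<Rightarrow> nat \<Rightarrow> nat \<Rightarrow> bool \<Rightarrow> nat list" where
  "letter_symbols f i j b =
    (if b then [f i, Suc (f i), f j, Suc (f j), Suc (f i), f i]
     else [Suc (f j), f j, Suc (f i), f i, f i, Suc (f i)])"

text \<open>From these symbols, productions for $D, D^{-1}, C, C^{-1}, E, E^{-1}$ in this order. They get the
numbers $d + 1, \ldots, d + 6$ if \<open>d\<close> productions come before them.\<close>

definition shared_productions :: "nat list \<Rightarrow> 'f compressed" where
  "shared_productions xs = map (map NonTerm)
    [[xs ! 0, xs ! 2], [xs ! 3, xs ! 1],
     [xs ! 0, xs ! 2, xs ! 1, xs ! 3], [xs ! 2, xs ! 0, xs ! 3, xs ! 1],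
     [xs ! 0, xs ! 2, xs ! 4], [xs ! 5, xs ! 3, xs ! 1]]"

text \<open>The symbols for $L, L^{-1}, M, M^{-1}$ if $x_r$ becomes $L x_r M$. The number 1 stands for the trivial word.\<close>

fun conj_symbols :: "nat \<Rightarrow> action_type \<Rightarrow> nat list" where
  "conj_symbols d Trivial = [1, 1, 1, 1]"
| "conj_symbols d Conj_D = [d + 1, d + 2, d + 2, d + 1]"
| "conj_symbols d Conj_C = [d + 3, d + 4, d + 4, d + 3]"
| "conj_symbols d Right_E = [1, 1, d + 6, d + 5]"
| "conj_symbols d Left_E_right_C = [d + 5, d + 6, d + 4, d + 3]"

definition letter_productions :: "nat list \<Rightarrow> nat \<Rightarrow> 'f compressed" where
  "letter_productions P q =
    [map NonTerm [P ! 0, q, P ! 2], map NonTerm [P ! 3, Suc q, P ! 1]]"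

definition block_productions :: "nat \<Rightarrow> nat \<Rightarrow> nat \<Rightarrow> (nat \<Rightarrow> nat) \<Rightarrow> nat \<Rightarrow> nat \<Rightarrow> 'f compressed" where
  "block_productions g i j f d r =
    concat (map (\<lambda>r. letter_productions (conj_symbols d (action_type g i j r)) (f r)) [1..<r])"

lemma block_productions_Suc:
  "1 \<le> r \<Longrightarrow> block_productions g i j f d (Suc r) =
    block_productions g i j f d r @ letter_productions (conj_symbols d (action_type g i j r)) (f r)"
  by (simp add: block_productions_def)

lemma block_productions_1: "block_productions g i j f d (Suc 0) = []"
  by (simp add: block_productions_def)

lemma length_block_productions: "1 \<le> r \<Longrightarrow> length (block_productions g i j f d r) = 2 * r - 2"
  by (induction r rule: nat_induct_at_least)
    (auto simp: block_productions_Suc block_productions_1 letter_productions_def)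

text \<open>The last production copies the old root \<open>d\<close>, which keeps its value: reading the letter $l$ changes
$\beta^{-1} v$ into $(l \beta)^{-1} l v$.\<close>

definition base_letter_productions where
  "base_letter_productions g i j b s f d =
     shared_productions (letter_symbols f i j b) @ block_productions g i j f d s @ [[NonTerm d]]"

lemma tracks_represents_letters:
  assumes t: "tracks g p n s v Ws f" and ij: "1 \<le> i" "i < s" "1 \<le> j" "j < s"
  shows "list_all2 (\<lambda>q l. braid_represents g p n (upto_strand (s - 1) v) Ws q [l])
    (letter_symbols f i j b)
    [fst_letter s i j b, inv_letter (fst_letter s i j b), snd_letter s i j b,
     inv_letter (snd_letter s i j b),
     inv_letter (if b then fst_letter s i j b else snd_letter s i j b),
     if b then fst_letter s i j b else snd_letter s i j b]"
  using assms by (simp add: tracks_def letter_symbols_def fst_letter_def snd_letter_def)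

lemma represents_shared:
  fixes b :: bool
  assumes t: "tracks g p n s v Ws f" and ij: "1 \<le> i" "i < s" "1 \<le> j" "j < s"
  defines "Vs \<equiv> Ws @ shared_productions (letter_symbols f i j b)"
    and "\<beta> \<equiv> upto_strand (s - 1) v"
  shows "compressed_word (strand_letters s) Vs \<and>
    braid_represents g p n \<beta> Vs (length Ws + 1) (word_D s i j b) \<and>
    braid_represents g p n \<beta> Vs (length Ws + 2) (inv_word (word_D s i j b)) \<and>
    braid_represents g p n \<beta> Vs (length Ws + 3) (word_C s i j b) \<and>
    braid_represents g p n \<beta> Vs (length Ws + 4) (inv_word (word_C s i j b)) \<and>
    braid_represents g p n \<beta> Vs (length Ws + 5) (word_E s i j b) \<and>
    braid_represents g p n \<beta> Vs (length Ws + 6) (inv_word (word_E s i j b))"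
proof -
  have w: "\<beta> \<in> words (gens g p n)" and cw: "compressed_word (strand_letters s) Ws"
    using t by (simp_all add: tracks_def represents_def \<beta>_def)
  define qss where "qss = (let xs = letter_symbols f i j b in
    [[xs ! 0, xs ! 2], [xs ! 3, xs ! 1],
     [xs ! 0, xs ! 2, xs ! 1, xs ! 3], [xs ! 2, xs ! 0, xs ! 3, xs ! 1],
     [xs ! 0, xs ! 2, xs ! 4], [xs ! 5, xs ! 3, xs ! 1]])"
  define us where "us = [word_D s i j b, inv_word (word_D s i j b), word_C s i j b,
    inv_word (word_C s i j b), word_E s i j b, inv_word (word_E s i j b)]"
  have "list_all2 (list_all2 (braid_represents g p n \<beta> Ws)) qss (map (map (\<lambda>l. [l])) us)"
    using tracks_represents_letters[OF t ij, of b]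
    by (cases b) (simp_all add: \<beta>_def qss_def us_def letter_symbols_def action_word_defs Let_def)
  note rep = represents_productions[OF cw w this]
  have len_us: "length us = 6" by (simp add: us_def)
  from rep have "compressed_word (strand_letters s) Vs \<and>
      (\<forall>k<6. braid_represents g p n \<beta> Vs (length Ws + k + 1) (us ! k))"
    by (simp add: Vs_def shared_productions_def qss_def Let_def len_us)
  then show ?thesis
    by (auto simp: us_def numeral_eq_Suc All_less_Suc)
qed

lemma represents_conj_symbols:
  fixes b :: bool and r :: nat
  assumes t: "tracks g p n s v Ws f" and ij: "1 \<le> i" "i < s" "1 \<le> j" "j < s"
  defines "Vs \<equiv> Ws @ shared_productions (letter_symbols f i j b)"
    and "\<beta> \<equiv> upto_strand (s - 1) v" and "P \<equiv> conj_symbols (length Ws) (action_type g i j r)"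
  shows "list_all2 (braid_represents g p n \<beta> Vs) P
    [left_word g s i j b r, inv_word (left_word g s i j b r),
     right_word g s i j b r, inv_word (right_word g s i j b r)]"
proof -
  have "Ws \<noteq> []" "Ws ! 0 = []" "\<beta> \<in> words (gens g p n)"
    using t by (auto simp: tracks_def compressed_word_def represents_def \<beta>_def)
  then have "braid_represents g p n \<beta> Vs 1 []"
    unfolding Vs_def by (intro represents_append represents_empty_production)
  then show ?thesis
    using represents_shared[OF t ij, of b]
    by (cases "action_type g i j r")
      (simp_all add: P_def Vs_def \<beta>_def left_word_def right_word_def)
qed

text \<open>All productions of the block are still about the old $\beta$; in that view $x_r$ is replaced by
$L x_r M$. Six shared productions come first, so the productions for $x_r$ and $x_r^{-1}$ are the ones
after $d + 6 + 2(r - 1)$ others.\<close>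

lemma represents_block:
  fixes b :: bool
  assumes t: "tracks g p n s v Ws f" and ij: "1 \<le> i" "i < s" "1 \<le> j" "j < s"
    and t: "1 \<le> t" "t \<le> s"
  defines "Vs \<equiv> Ws @ shared_productions (letter_symbols f i j b) @ block_productions g i j f (length Ws) t"
    and "\<beta> \<equiv> upto_strand (s - 1) v"
  shows "compressed_word (strand_letters s) Vs \<and> (\<forall>r. 1 \<le> r \<and> r < t \<longrightarrow>
    braid_represents g p n \<beta> Vs (length Ws + 5 + 2 * r) (acted g s i j b r) \<and>
    braid_represents g p n \<beta> Vs (Suc (length Ws + 5 + 2 * r)) (inv_word (acted g s i j b r)))"
  using t unfolding Vs_def
proof (induction t rule: nat_induct_at_least)
  case base
  then show ?case using represents_shared[OF assms(1) ij, of b] by (simp add: block_productions_1)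
next
  case (Suc t)
  let ?Ws = "Ws @ shared_productions (letter_symbols f i j b)"
  let ?Vs = "?Ws @ block_productions g i j f (length Ws) t"
  have IH: "compressed_word (strand_letters s) ?Vs" and
    IH': "\<And>r. 1 \<le> r \<Longrightarrow> r < t \<Longrightarrow> braid_represents g p n \<beta> ?Vs (length Ws + 5 + 2 * r) (acted g s i j b r)"
     "\<And>r. 1 \<le> r \<Longrightarrow> r < t \<Longrightarrow> braid_represents g p n \<beta> ?Vs (Suc (length Ws + 5 + 2 * r)) (inv_word (acted g s i j b r))"
    using Suc by simp_all
  have \<beta>: "\<beta> \<in> words (gens g p n)"
    using assms(1) by (simp add: tracks_def represents_def \<beta>_def)
  obtain P where P: "conj_symbols (length Ws) (action_type g i j t) = P" by simp
  obtain P0 P1 P2 P3 where P': "P = [P0, P1, P2, P3]"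
    using P by (cases "action_type g i j t") auto
  have "list_all2 (braid_represents g p n \<beta> ?Vs) P
    [left_word g s i j b t, inv_word (left_word g s i j b t),
     right_word g s i j b t, inv_word (right_word g s i j b t)]"
    unfolding P[symmetric] \<beta>_def
    by (rule list_all2_mono[OF represents_conj_symbols[OF assms(1) ij, of b] represents_append])
  moreover have "braid_represents g p n \<beta> ?Vs (f t) [A t s]"
    "braid_represents g p n \<beta> ?Vs (Suc (f t)) [A' t s]"
    using assms(1) Suc by (auto simp: \<beta>_def tracks_def intro!: represents_append)
  ultimately have *: "list_all2 (list_all2 (braid_represents g p n \<beta> ?Vs))
     [[P0, f t, P2], [P3, Suc (f t), P1]]
     [[left_word g s i j b t, [A t s], right_word g s i j b t],
      [inv_word (right_word g s i j b t), [A' t s], inv_word (left_word g s i j b t)]]"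
    by (simp add: P')
  have len: "length ?Vs = length Ws + 4 + 2 * t"
    using Suc by (simp add: length_block_productions shared_productions_def)
  have ext: "Ws @ shared_productions (letter_symbols f i j b) @ block_productions g i j f (length Ws) (Suc t)
    = ?Vs @ letter_productions P (f t)"
    using Suc P by (simp add: block_productions_Suc)
  have new: "letter_productions P (f t) = map (map NonTerm) [[P0, f t, P2], [P3, Suc (f t), P1]]"
    by (simp add: letter_productions_def P')
  from represents_productions[OF IH \<beta> *] len
  have "compressed_word (strand_letters s) (?Vs @ letter_productions P (f t))"
    "braid_represents g p n \<beta> (?Vs @ letter_productions P (f t)) (length Ws + 5 + 2 * t) (acted g s i j b t)"
    "braid_represents g p n \<beta> (?Vs @ letter_productions P (f t)) (Suc (length Ws + 5 + 2 * t))
       (inv_word (acted g s i j b t))"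
    unfolding new by (auto simp: All_less_Suc numeral_eq_Suc)
  moreover note represents_append[OF IH'(1), of _ "letter_productions P (f t)"]
    represents_append[OF IH'(2), of _ "letter_productions P (f t)"]
  ultimately show ?case unfolding ext less_Suc_eq by blast
qed

text \<open>Passing from $\beta$ to $l \beta$ turns the nonterminals for $L x_r M = l^{-1} x_r l$ into nonterminals
for $x_r$.\<close>

lemma tracks_base_letter:
  assumes t: "tracks g p n s v Ws f" and ij: "(i, j) \<in> gens g p n" "j < s"
    and s: "\<And>r. 1 \<le> r \<Longrightarrow> r < s \<Longrightarrow> (r, s) \<in> gens g p n"
  shows "tracks g p n s (((i, j), b) # v) (Ws @ base_letter_productions g i j b s f (length Ws))
    (\<lambda>r. length Ws + 5 + 2 * r)"
proof -
  let ?\<beta> = "upto_strand (s - 1) v" and ?x = "[((i, j), b)]"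
  let ?Vs = "Ws @ shared_productions (letter_symbols f i j b) @ block_productions g i j f (length Ws) s"
  let ?Us = "?Vs @ [map NonTerm [length Ws]]"
  let ?u = "upto_strand s v @ inv_word ?\<beta>"
  have ij': "1 \<le> i" "i < s" "1 \<le> j" "j < s" "1 \<le> s" "i < j"
    using ij by (auto simp: gens_def)
  note block = represents_block[OF t ij'(1-4) ij'(5) order.refl, of b]
  have R: "braid_represents g p n ?\<beta> Ws (length Ws) ?u" and Ws: "Ws \<noteq> []" "Ws ! 0 = []"
    using t by (auto simp: tracks_def compressed_word_def)
  have w: "?\<beta> \<in> words (gens g p n)" "upto_strand s v \<in> words (gens g p n)" "?x \<in> words (gens g p n)"
    using R ij by (simp_all add: represents_def)
  have "list_all2 (list_all2 (braid_represents g p n ?\<beta> ?Vs)) [[length Ws]] [[?u]]"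
    using R by (simp add: represents_append)
  from represents_productions[OF conjunct1[OF block] w(1) this]
  have cw: "compressed_word (strand_letters s) ?Us"
    and root: "braid_represents g p n ?\<beta> ?Us (length ?Us) ?u" by auto
  have conj: "braid_eq g p n (inv_word ?x @ [A r s] @ ?x) (acted g s i j b r)" if "1 \<le> r" "r < s" for r
    using braid_eq_conj[OF ij(1) s[OF that] ij(2)] by simp
  have letters: "braid_represents g p n (?x @ ?\<beta>) ?Us (length Ws + 5 + 2 * r) [A r s]"
      "braid_represents g p n (?x @ ?\<beta>) ?Us (Suc (length Ws + 5 + 2 * r)) [A' r s]"
    if r: "1 \<le> r" "r < s" for r
  proof -
    have "braid_represents g p n ?\<beta> ?Us (length Ws + 5 + 2 * r) (acted g s i j b r)"
      "braid_represents g p n ?\<beta> ?Us (Suc (length Ws + 5 + 2 * r)) (inv_word (acted g s i j b r))"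
      using block r by (blast intro: represents_append)+
    then show "braid_represents g p n (?x @ ?\<beta>) ?Us (length Ws + 5 + 2 * r) [A r s]"
      "braid_represents g p n (?x @ ?\<beta>) ?Us (Suc (length Ws + 5 + 2 * r)) [A' r s]"
      using represents_conjugate[OF _ conj[OF r]]
        represents_conjugate[OF _ pres_eq_conj_inv[OF conj[OF r]]] s[OF r] w(3) by auto
  qed
  have "braid_eq g p n (inv_word ?x @ (?x @ ?u @ inv_word ?x) @ ?x) (?u @ inv_word ?x @ ?x)"
    using pres_eq_cancel_left[of "[]" "gens g p n" ?x "?u @ inv_word ?x @ ?x"] w by simp
  also have "braid_eq g p n \<dots> ?u"
    using pres_eq_cancel_left[of ?u "gens g p n" ?x "[]"] w by simp
  finally have "braid_represents g p n (?x @ ?\<beta>) ?Us (length ?Us) (?x @ ?u @ inv_word ?x)"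
    using root w by (intro represents_conjugate) auto
  moreover have "j \<le> s - 1" "j \<le> s" using ij by simp_all
  moreover have "Ws @ base_letter_productions g i j b s f (length Ws) = ?Us"
    by (simp add: base_letter_productions_def)
  ultimately show ?thesis
    unfolding tracks_def using cw letters Ws by (simp add: nth_append)
qed

lemma tracks_ev:
  assumes t: "tracks g p n (strand_index g p k) w Ws f" and k: "1 \<le> k"
  shows "ev Ws \<in> lists (strand_letters (strand_index g p k))"
    and "braid_eq g p n (ev Ws) (factor_word g p k w)"
proof -
  let ?s = "strand_index g p k" and ?\<beta> = "upto_strand (strand_index g p (k - 1)) w"
  have s: "?s - 1 = strand_index g p (k - 1)" using k by (cases k) (simp_all add: strand_index_def)
  have cw: "compressed_word (strand_letters ?s) Ws" using t by (simp add: tracks_def)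
  then have "length Ws > 0" by (simp add: compressed_word_def)
  with concat_values_in_lists[OF cw] show "ev Ws \<in> lists (strand_letters ?s)"
    by (simp add: ev_eq_last_value[OF cw])
  have rep: "braid_represents g p n ?\<beta> Ws (length Ws) (upto_strand ?s w @ inv_word ?\<beta>)"
    using t unfolding tracks_def s by blast
  then have w: "?\<beta> \<in> words (gens g p n)" "upto_strand ?s w \<in> words (gens g p n)"
    by (simp_all add: represents_def)
  have "braid_eq g p n (ev Ws) (inv_word ?\<beta> @ upto_strand ?s w @ inv_word ?\<beta> @ ?\<beta>)"
    using rep by (simp add: represents_def ev_eq_last_value[OF cw])
  also have "braid_eq g p n \<dots> (factor_word g p k w)"
    using pres_eq_cancel_left[of "inv_word ?\<beta> @ upto_strand ?s w" "gens g p n" ?\<beta> "[]"] w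
    by (simp add: factor_word_def)
  finally show "braid_eq g p n (ev Ws) (factor_word g p k w)" .
qed

text \<open>The compressed words also give the existence of the combed normal form: their evaluations are words in
the letters of one strand.\<close>

lemma tracks_exists:
  assumes s: "\<And>r. 1 \<le> r \<Longrightarrow> r < s \<Longrightarrow> (r, s) \<in> gens g p n" and "1 \<le> s" and "w \<in> words (gens g p n)"
  shows "\<exists>Ws f. tracks g p n s w Ws f"
  using assms(3)
proof (induction w rule: list.induct)
  case Nil
  show ?case using init_tracks[OF s \<open>1 \<le> s\<close>] by blast
next
  case (Cons l w)
  obtain i j b where l: "l = ((i, j), b)" by (metis prod.exhaust)
  then have ij: "(i, j) \<in> gens g p n" using Cons.prems by simp
  obtain Ws f where t: "tracks g p n s w Ws f" using Cons by auto
  consider "j < s" | "j = s" | "s < j" by linarith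
  then show ?case
    unfolding l
  proof cases
    case 1
    then show "\<exists>Ws f. tracks g p n s (((i, j), b) # w) Ws f"
      using tracks_base_letter[OF t ij 1 s] by blast
  next
    case 2
    then show "\<exists>Ws f. tracks g p n s (((i, j), b) # w) Ws f"
      using tracks_strand_letter[OF t, of i b] ij by (auto simp: gens_def)
  next
    case 3
    then show "\<exists>Ws f. tracks g p n s (((i, j), b) # w) Ws f"
      using tracks_skip[OF t] by blast
  qed
qed

lemma strand_gens:
  assumes "p > 0" "1 \<le> k" "k \<le> n"
  shows "1 \<le> r \<Longrightarrow> r < strand_index g p k \<Longrightarrow> (r, strand_index g p k) \<in> gens g p n"
  using assms by (auto simp: gens_def strand_index_def)

lemma combed_factor_factor_word:
  assumes "p > 0" "1 \<le> k" "k \<le> n" "w \<in> words (gens g p n)"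
  shows "combed_factor g p n k (braid g p n w) = braid g p n (factor_word g p k w)"
proof (rule combed_factor_eq[OF assms(1,4,2,3)])
  fix k assume k: "1 \<le> k" "k \<le> n"
  have "1 \<le> strand_index g p k" using k by (simp add: strand_index_def)
  from tracks_exists[OF strand_gens[OF assms(1) k] this assms(4)]
  obtain Ws f where "tracks g p n (strand_index g p k) w Ws f" by blast
  from tracks_ev[OF this k(1)]
  show "\<exists>u\<in>lists (strand_letters (strand_index g p k)). braid_eq g p n u (factor_word g p k w)"
    by blast
qed

section \<open>Counting symbols\<close>

lemma compressed_size_simps [simp]:
  "compressed_size [] = 0" "compressed_size (W # Ws) = length W + compressed_size Ws"
  "compressed_size (Ws @ Vs) = compressed_size Ws + compressed_size Vs"
  by (simp_all add: compressed_size_def)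

lemma compressed_size_init: "1 \<le> r \<Longrightarrow> compressed_size (init_productions s r) = 2 * (r - 1)"
  by (induction r rule: nat_induct_at_least) (auto simp: init_productions_Suc, simp add: init_productions_def)

lemma compressed_size_block: "1 \<le> r \<Longrightarrow> compressed_size (block_productions g i j f d r) = 6 * (r - 1)"
  by (induction r rule: nat_induct_at_least)
    (auto simp: block_productions_Suc block_productions_1 letter_productions_def)

lemma compressed_size_base_letter:
  "1 \<le> s \<Longrightarrow> compressed_size (base_letter_productions g i j b s f d) = 6 * (s - 1) + 19"
  by (simp add: base_letter_productions_def compressed_size_block shared_productions_def)

section \<open>Postconditions with running time\<close>

text \<open>The program started in \<open>st\<close> stops after some \<open>t\<close> steps in a state \<open>st'\<close> such that \<open>Q t st'\<close>. Having the
time in the postcondition lets bounds on the parts of a program add up during symbolic execution.\<close>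

definition wp :: "com \<Rightarrow> (nat \<Rightarrow> state \<Rightarrow> bool) \<Rightarrow> state \<Rightarrow> bool" where
  "wp c Q st \<longleftrightarrow> (\<exists>t st'. runs c st t st' \<and> Q t st')"

inductive_cases runs_elims:
  "runs Skip s t s'" "runs (Set x c) s t s'" "runs (Copy x y) s t s'" "runs (Inc x) s t s'"
  "runs (Dec x) s t s'" "runs (Load x a y) s t s'" "runs (Store a y x) s t s'"
  "runs (Seq c d) s t s'" "runs (Cond b c d) s t s'"

lemma wp_simps:
  "wp Skip Q = Q 1"
  "wp (Set x m) Q (\<rho>, \<mu>) \<longleftrightarrow> Q 1 (\<rho>(x := m), \<mu>)"
  "wp (Copy x y) Q (\<rho>, \<mu>) \<longleftrightarrow> Q 1 (\<rho>(x := \<rho> y), \<mu>)"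
  "wp (Inc x) Q (\<rho>, \<mu>) \<longleftrightarrow> Q 1 (\<rho>(x := Suc (\<rho> x)), \<mu>)"
  "wp (Dec x) Q (\<rho>, \<mu>) \<longleftrightarrow> Q 1 (\<rho>(x := \<rho> x - 1), \<mu>)"
  "wp (Load x a y) Q (\<rho>, \<mu>) \<longleftrightarrow> Q 1 (\<rho>(x := \<mu> a (\<rho> y)), \<mu>)"
  "wp (Store a y x) Q (\<rho>, \<mu>) \<longleftrightarrow> Q 1 (\<rho>, \<mu>(a := (\<mu> a)(\<rho> y := \<rho> x)))"
  "wp (Seq c d) Q = wp c (\<lambda>t. wp d (\<lambda>t'. Q (t + t')))"
  unfolding wp_def fun_eq_iff by (fastforce elim!: runs_elims intro: runs.intros runs.Inc[simplified])+

lemma wp_Cond: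
  assumes "test_val b st \<Longrightarrow> wp c (\<lambda>t. Q (t + 1)) st" "\<not> test_val b st \<Longrightarrow> wp d (\<lambda>t. Q (t + 1)) st"
  shows "wp (Cond b c d) Q st"
  using assms runs.CondTrue runs.CondFalse unfolding wp_def by blast

text \<open>A loop with a known number \<open>K\<close> of rounds; the invariant counts them.\<close>

lemma wp_While:
  assumes inv: "I 0 st"
    and step: "\<And>k st. k < K \<Longrightarrow> I k st \<Longrightarrow>
       test_val b st \<and> wp c (\<lambda>t st'. t \<le> T \<and> I (Suc k) st') st"
    and stop: "\<And>st. I K st \<Longrightarrow> \<not> test_val b st"
    and post: "\<And>t st'. t \<le> K * (T + 1) + 1 \<Longrightarrow> I K st' \<Longrightarrow> Q t st'"
  shows "wp (While b c) Q st"
proof -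
  have "\<exists>t st'. runs (While b c) st t st' \<and> t \<le> (K - k) * (T + 1) + 1 \<and> I K st'"
    if "k \<le> K" "I k st" for k st
    using that
  proof (induction "K - k" arbitrary: k st)
    case 0
    then have "I K st" by simp
    with runs.WhileFalse[OF stop[OF this], of c] show ?case by (intro exI[of _ 1] exI[of _ st]) simp
  next
    case (Suc l)
    then have k: "k < K" by simp
    from step[OF k Suc.prems(2)] obtain t st' where
      1: "test_val b st" "runs c st t st'" "t \<le> T" "I (Suc k) st'" by (auto simp: wp_def)
    have "l = K - Suc k" "Suc k \<le> K" using Suc.hyps(2) k by simp_all
    from Suc.hyps(1)[OF this 1(4)] obtain t' st'' where
      2: "runs (While b c) st' t' st''" "t' \<le> (K - Suc k) * (T + 1) + 1" "I K st''" by blast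
    have "(K - k) * (T + 1) = (K - Suc k) * (T + 1) + (T + 1)"
      using k by (metis Suc_diff_Suc add.commute mult_Suc)
    with runs.WhileTrue[OF 1(1,2) 2(1)] 1 2 show ?case
      by (intro exI[of _ "t + t' + 1"] exI[of _ st'']) simp
  qed
  from this[OF le0 inv] obtain t st' where
    "runs (While b c) st t st'" "t \<le> (K - 0) * (T + 1) + 1" "I K st'" by blast
  then show ?thesis using post unfolding wp_def diff_zero by blast
qed

fun seqs :: "com list \<Rightarrow> com" where
  "seqs [] = Skip"
| "seqs (c # cs) = Seq c (seqs cs)"

section \<open>Registers and output\<close>

text \<open>
The first three registers hold the constants 0, 2, 1. Then come the output position, the number of
productions written so far and an auxiliary register; $g$, $p$, the strand index $s$ (first $k$), the
number of letters still to be read and the input position; the indices and the sign of the current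
letter; the symbols for $a, a^{-1}, c, c^{-1}, e, e^{-1}$ and $D, D^{-1}, C, C^{-1}, E, E^{-1}$; the loop
variable $r$ with $r + 1$ and its parity; the symbols for $L, L^{-1}, M, M^{-1}$ and
$x_r, x_r^{-1}$; $i + 1$, $2g + 1$, the old root and a counter.
\<close>

abbreviation (input) "rZero \<equiv> 2 :: nat"
abbreviation (input) "rTwo \<equiv> 3 :: nat"
abbreviation (input) "rOne \<equiv> 4 :: nat"
abbreviation (input) "rOut \<equiv> 5 :: nat"
abbreviation (input) "rCnt \<equiv> 6 :: nat"
abbreviation (input) "rTmp \<equiv> 7 :: nat"
abbreviation (input) "rGenus \<equiv> 8 :: nat"
abbreviation (input) "rBound \<equiv> 9 :: nat"
abbreviation (input) "rStrand \<equiv> 10 :: nat"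
abbreviation (input) "rLeft \<equiv> 11 :: nat"
abbreviation (input) "rPtr \<equiv> 12 :: nat"
abbreviation (input) "rI \<equiv> 14 :: nat"
abbreviation (input) "rJ \<equiv> 15 :: nat"
abbreviation (input) "rB \<equiv> 16 :: nat"
abbreviation (input) "ra \<equiv> 17 :: nat"
abbreviation (input) "ra' \<equiv> 18 :: nat"
abbreviation (input) "rc \<equiv> 19 :: nat"
abbreviation (input) "rc' \<equiv> 20 :: nat"
abbreviation (input) "re \<equiv> 21 :: nat"
abbreviation (input) "re' \<equiv> 22 :: nat"
abbreviation (input) "rD \<equiv> 23 :: nat"
abbreviation (input) "rD' \<equiv> 24 :: nat"
abbreviation (input) "rC \<equiv> 25 :: nat"
abbreviation (input) "rC' \<equiv> 26 :: nat"
abbreviation (input) "rE \<equiv> 27 :: nat"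
abbreviation (input) "rE' \<equiv> 28 :: nat"
abbreviation (input) "rR \<equiv> 29 :: nat"
abbreviation (input) "rR1 \<equiv> 30 :: nat"
abbreviation (input) "rPar \<equiv> 31 :: nat"
abbreviation (input) "rP0 \<equiv> 32 :: nat"
abbreviation (input) "rP1 \<equiv> 33 :: nat"
abbreviation (input) "rP2 \<equiv> 34 :: nat"
abbreviation (input) "rP3 \<equiv> 35 :: nat"
abbreviation (input) "rX \<equiv> 36 :: nat"
abbreviation (input) "rX' \<equiv> 37 :: nat"
abbreviation (input) "rI1 \<equiv> 38 :: nat"
abbreviation (input) "rG \<equiv> 39 :: nat"
abbreviation (input) "rRoot \<equiv> 40 :: nat"
abbreviation (input) "rK \<equiv> 41 :: nat"

primrec emits :: "nat list \<Rightarrow> com" where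
  "emits [] = Skip"
| "emits (x # xs) = Seq (Store 1 rOut x) (Seq (Inc rOut) (emits xs))"

definition encode_production :: "(nat \<times> nat) letter sym list \<Rightarrow> nat list" where
  "encode_production W = length W # concat (map encode_sym W)"

text \<open>Output starts at position 1 of the array, because position 0 is reserved for the number of
productions, which is known only at the end.\<close>

definition written_list :: "nat list \<Rightarrow> nat \<Rightarrow> (nat \<Rightarrow> nat) \<Rightarrow> bool" where
  "written_list E out B \<longleftrightarrow> out = Suc (length E) \<and> (\<forall>i<length E. B (Suc i) = E ! i)"

definition written :: "(nat \<times> nat) letter compressed \<Rightarrow> nat \<Rightarrow> nat \<Rightarrow> (nat \<Rightarrow> nat) \<Rightarrow> bool" where
  "written Ws out cnt B \<longleftrightarrow>
     cnt = length Ws \<and> written_list (concat (map encode_production Ws)) out B"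

lemma has_output_written:
  assumes "written Ws out cnt (\<mu> 1)"
  shows "has_output (\<rho>, \<mu>(1 := (\<mu> 1)(0 := cnt))) (encode_compressed Ws)"
proof -
  have "encode_compressed Ws = length Ws # concat (map encode_production Ws)"
    by (simp add: encode_compressed_def encode_production_def[abs_def])
  then show ?thesis
    using assms by (auto simp: has_output_def written_def written_list_def less_Suc_eq_0_disj)
qed

lemma wp_emits:
  assumes "written_list E (\<rho> rOut) (\<mu> 1)" "rOut \<notin> set xs"
    and "\<And>t out B. t \<le> 2 * length xs + 1 \<Longrightarrow> written_list (E @ map \<rho> xs) out B \<Longrightarrow>
      Q t (\<rho>(rOut := out), \<mu>(1 := B))"
  shows "wp (emits xs) Q (\<rho>, \<mu>)"
  using assms
proof (induction xs arbitrary: E \<rho> \<mu> Q)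
  case Nil
  then show ?case using Nil(3)[of 1 "\<rho> rOut" "\<mu> 1"] by (simp add: wp_simps)
next
  case (Cons x xs)
  let ?\<rho> = "\<rho>(rOut := Suc (\<rho> rOut))" and ?B = "(\<mu> 1)(\<rho> rOut := \<rho> x)"
  have "wp (emits xs) (\<lambda>t. Q (1 + (1 + t))) (?\<rho>, \<mu>(1 := ?B))"
  proof (rule Cons.IH)
    show "written_list (E @ [\<rho> x]) (?\<rho> rOut) ((\<mu>(1 := ?B)) 1)"
      using Cons.prems(1) by (auto simp: written_list_def nth_append less_Suc_eq)
    show "rOut \<notin> set xs" using Cons.prems by simp
  next
    fix t out B
    assume t: "t \<le> 2 * length xs + 1" and w: "written_list ((E @ [\<rho> x]) @ map ?\<rho> xs) out B"
    have "map ?\<rho> xs = map \<rho> xs" using Cons.prems(2) by auto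
    with w have "written_list (E @ map \<rho> (x # xs)) out B" by simp
    then show "Q (1 + (1 + t)) (?\<rho>(rOut := out), (\<mu>(1 := ?B))(1 := B))"
      unfolding fun_upd_upd using t by (intro Cons.prems(3)) simp_all
  qed
  then show ?case by (simp add: wp_simps)
qed

definition emit_production :: "nat list \<Rightarrow> com" where
  "emit_production xs =
     seqs [Set rTmp (length xs), emits (rTmp # concat (map (\<lambda>x. [x, rZero, rTwo]) xs)), Inc rCnt]"

lemma length_emitted: "length (concat (map (\<lambda>x. [x, rZero, rTwo]) xs)) = 3 * length xs"
  by (induction xs) auto

lemma wp_emit_production:
  assumes "written Ws (\<rho> rOut) (\<rho> rCnt) (\<mu> 1)" "\<rho> rZero = 0" "\<rho> rTwo = 2"
    and xs: "set xs \<inter> {rOut, rCnt, rTmp} = {}"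
    and Q: "\<And>t out B. t \<le> 6 * length xs + 6 \<Longrightarrow>
      written (Ws @ [map NonTerm (map \<rho> xs)]) out (Suc (\<rho> rCnt)) B \<Longrightarrow>
      Q t (\<rho>(rTmp := length xs, rOut := out, rCnt := Suc (\<rho> rCnt)), \<mu>(1 := B))"
  shows "wp (emit_production xs) Q (\<rho>, \<mu>)"
proof -
  let ?\<rho> = "\<rho>(rTmp := length xs)" and ?ys = "rTmp # concat (map (\<lambda>x. [x, rZero, rTwo]) xs)"
  let ?W = "map NonTerm (map \<rho> xs) :: (nat \<times> nat) letter sym list"
  have "rTmp \<notin> set xs" "rOut \<notin> set xs" using xs by auto
  then have "map ?\<rho> (concat (map (\<lambda>x. [x, rZero, rTwo]) xs)) = concat (map encode_sym ?W)"
    using assms(2,3) by (induction xs) auto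
  then have m: "map ?\<rho> ?ys = encode_production ?W"
    by (simp add: encode_production_def)
  have "wp (emits ?ys) (\<lambda>t. wp (Inc rCnt) (\<lambda>t'. Q (1 + (t + (t' + 1))))) (?\<rho>, \<mu>)"
  proof (rule wp_emits)
    show "written_list (concat (map encode_production Ws)) (?\<rho> rOut) (\<mu> 1)"
      using assms(1) by (simp add: written_def)
    show "rOut \<notin> set ?ys" using xs by auto
  next
    fix t out B
    assume t: "t \<le> 2 * length ?ys + 1"
      and "written_list (concat (map encode_production Ws) @ map ?\<rho> ?ys) out B"
    then have "written (Ws @ [?W]) out (Suc (\<rho> rCnt)) B"
      using assms(1) unfolding m by (simp add: written_def)
    from Q[OF _ this, of "1 + (t + (1 + 1))"] t length_emitted[of xs]
    show "wp (Inc rCnt) (\<lambda>t'. Q (1 + (t + (t' + 1))))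
        (?\<rho>(rOut := out), \<mu>(1 := B))"
      by (simp add: wp_simps fun_upd_twist)
  qed
  then show ?thesis unfolding emit_production_def seqs.simps wp_simps .
qed

text \<open>Emitting does not touch the registers that hold the symbols, so several productions can be read off the state at the start.\<close>

lemma wp_emit_productions:
  assumes "written Ws (\<rho> rOut) (\<rho> rCnt) (\<mu> 1)" "\<rho> rZero = 0" "\<rho> rTwo = 2"
    and "\<forall>xs\<in>set xss. set xs \<inter> {rOut, rCnt, rTmp} = {}"
    and "\<And>t tmp out cnt B. t \<le> (\<Sum>xs\<leftarrow>xss. 6 * length xs + 6) + 1 \<Longrightarrow>
      written (Ws @ map (map NonTerm) (map (map \<rho>) xss)) out cnt B \<Longrightarrow>
      Q t (\<rho>(rTmp := tmp, rOut := out, rCnt := cnt), \<mu>(1 := B))"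
  shows "wp (seqs (map emit_production xss)) Q (\<rho>, \<mu>)"
  using assms
proof (induction xss arbitrary: Ws \<rho> \<mu> Q)
  case Nil
  then show ?case using Nil(5)[of 1 "\<rho> rOut" "\<rho> rCnt" "\<mu> 1" "\<rho> rTmp"] by (simp add: wp_simps)
next
  case (Cons xs xss)
  show ?case
    unfolding list.map seqs.simps wp_simps
  proof (rule wp_emit_production[where Ws = Ws])
    show "set xs \<inter> {rOut, rCnt, rTmp} = {}" using Cons.prems(4) by simp
  next
    fix t out B
    let ?\<rho> = "\<rho>(rTmp := length xs, rOut := out, rCnt := Suc (\<rho> rCnt))"
    assume t: "t \<le> 6 * length xs + 6"
      and w: "written (Ws @ [map NonTerm (map \<rho> xs)]) out (Suc (\<rho> rCnt)) B"
    show "wp (seqs (map emit_production xss)) (\<lambda>t'. Q (t + t')) (?\<rho>, \<mu>(1 := B))"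
    proof (rule Cons.IH[where Ws = "Ws @ [map NonTerm (map \<rho> xs)]"])
      fix t' tmp out' cnt B'
      assume t': "t' \<le> (\<Sum>xs\<leftarrow>xss. 6 * length xs + 6) + 1" and
        w': "written ((Ws @ [map NonTerm (map \<rho> xs)]) @ map (map NonTerm) (map (map ?\<rho>) xss)) out' cnt B'"
      have eq: "map (map ?\<rho>) xss = map (map \<rho>) xss" using Cons.prems(4) by auto
      have "written (Ws @ map (map NonTerm) (map (map \<rho>) (xs # xss))) out' cnt B'"
        using w'[unfolded eq] by simp
      moreover have "?\<rho>(rTmp := tmp, rOut := out', rCnt := cnt) = \<rho>(rTmp := tmp, rOut := out', rCnt := cnt)"
        by (simp add: fun_upd_twist)
      ultimately show "Q (t + t') (?\<rho>(rTmp := tmp, rOut := out', rCnt := cnt), (\<mu>(1 := B))(1 := B'))"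
        using t t' by (simp only: fun_upd_upd) (intro Cons.prems(5), simp_all)
    qed (use w Cons.prems in simp_all)
  qed (use Cons.prems(1-3) in simp_all)
qed

section \<open>Processing one letter\<close>

definition frame_registers :: "nat \<Rightarrow> nat \<Rightarrow> (nat \<Rightarrow> nat) \<Rightarrow> bool" where
  "frame_registers g s \<rho> \<longleftrightarrow> \<rho> rZero = 0 \<and> \<rho> rOne = 1 \<and> \<rho> rTwo = 2 \<and> \<rho> rStrand = s \<and> \<rho> rG = 2 * g + 1"

definition set_conj :: "nat list \<Rightarrow> com" where
  "set_conj xs = seqs [Copy rP0 (xs ! 0), Copy rP1 (xs ! 1), Copy rP2 (xs ! 2), Copy rP3 (xs ! 3)]"

text \<open>The case distinction of \<open>action_type\<close>, with parity and successors read from registers.\<close>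

definition choose_conj :: com where
  "choose_conj =
    (let trivial = set_conj [rOne, rOne, rOne, rOne];
         conj_D = set_conj [rD, rD', rD', rD];
         conj_C = set_conj [rC, rC', rC', rC];
         right_E = set_conj [rOne, rOne, rE', rE];
         left_E_right_C = set_conj [rE, rE', rC', rC]
     in Cond (Eq rR rI) conj_D (Cond (Eq rR rJ) conj_D
       (Cond (Less rR rI)
         (Cond (Eq rR1 rI)
           (Cond (Eq rPar rOne) (Cond (Less rR rG) right_E trivial) trivial) trivial)
         (Cond (Less rR rJ)
           (Cond (Eq rR rI1)
             (Cond (Eq rPar rZero) (Cond (Less rR rG) left_E_right_C conj_C) conj_C) conj_C)
           trivial))))"

definition conj_registers :: "nat \<Rightarrow> (nat \<Rightarrow> nat) \<Rightarrow> bool" where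
  "conj_registers d \<rho> \<longleftrightarrow> \<rho> rZero = 0 \<and> \<rho> rOne = 1 \<and> \<rho> rTwo = 2 \<and>
     \<rho> rD = d + 1 \<and> \<rho> rD' = d + 2 \<and> \<rho> rC = d + 3 \<and> \<rho> rC' = d + 4 \<and> \<rho> rE = d + 5 \<and> \<rho> rE' = d + 6"

lemma wp_choose_conj:
  assumes "conj_registers d \<rho>" "\<rho> rR1 = Suc (\<rho> rR)" "\<rho> rPar = \<rho> rR mod 2"
    "\<rho> rI1 = Suc (\<rho> rI)" "\<rho> rG = 2 * g + 1"
    and P: "conj_symbols d (action_type g (\<rho> rI) (\<rho> rJ) (\<rho> rR)) = [L, L', M, M']"
    and Q: "\<And>t. t \<le> 12 \<Longrightarrow> Q t (\<rho>(rP0 := L, rP1 := L', rP2 := M, rP3 := M'), \<mu>)"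
  shows "wp choose_conj Q (\<rho>, \<mu>)"
proof -
  have par: "\<rho> rPar = Suc 0 \<longleftrightarrow> odd (\<rho> rR)" "\<rho> rPar = 0 \<longleftrightarrow> even (\<rho> rR)"
    unfolding assms(3) by presburger+
  have regs: "\<rho> rOne = Suc 0" "\<rho> rZero = 0" "\<rho> rD = d + 1" "\<rho> rD' = d + 2" "\<rho> rC = d + 3"
    "\<rho> rC' = d + 4" "\<rho> rE = d + 5" "\<rho> rE' = d + 6"
    using assms(1) by (simp_all add: conj_registers_def)
  have leaf: "wp (set_conj xs) Q' (\<rho>, \<mu>)"
    if "Q' 5 (\<rho>(rP0 := L, rP1 := L', rP2 := M, rP3 := M'), \<mu>)" "map \<rho> xs = [L, L', M, M']"
      "set xs \<inter> {rP0, rP1, rP2, rP3} = {}" for xs Q'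
    using that by (auto simp: set_conj_def wp_simps numeral_eq_Suc)
  note type = P[unfolded action_type_def]
  show ?thesis
    unfolding choose_conj_def Let_def
    by (intro wp_Cond; rule leaf; use type in \<open>simp add: regs par assms(2,4,5) Q\<close>)
qed

text \<open>The array entry for $x_r$ is overwritten before its productions are emitted, when the number of the next
production is at hand; the old symbol is in a register by then.\<close>

definition block_body :: com where
  "block_body = seqs [choose_conj, Load rX 2 rR, Copy rX' rX, Inc rX',
     Copy rTmp rCnt, Inc rTmp, Store 2 rR rTmp,
     emit_production [rP0, rX, rP2], emit_production [rP3, rX', rP1],
     Inc rR, Inc rR1, Cond (Eq rPar rZero) (Copy rPar rOne) (Copy rPar rZero)]"

definition block_loop :: com where
  "block_loop = seqs [Set rR 1, Set rR1 2, Copy rPar rOne, While (Less rR rStrand) block_body]"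

abbreviation "block_scratch \<equiv> {rR, rR1, rPar, rP0, rP1, rP2, rP3, rX, rX', rTmp, rOut, rCnt}"

text \<open>The array in the middle of a block: the entries below \<open>r\<close> are new, the others still those of \<open>f\<close>.\<close>

definition block_array :: "nat \<Rightarrow> nat \<Rightarrow> (nat \<Rightarrow> nat) \<Rightarrow> nat \<Rightarrow> nat" where
  "block_array d r f = (\<lambda>q. if 1 \<le> q \<and> q < r then d + 5 + 2 * q else f q)"

lemma block_array_Suc: "1 \<le> r \<Longrightarrow> (block_array d r f)(r := d + 5 + 2 * r) = block_array d (Suc r) f"
  by (auto simp: block_array_def)

definition block_inv ::
  "(nat \<times> nat) letter compressed \<Rightarrow> nat \<Rightarrow> nat \<Rightarrow> (nat \<Rightarrow> nat) \<Rightarrow> (nat \<Rightarrow> nat \<Rightarrow> nat)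
    \<Rightarrow> nat \<Rightarrow> state \<Rightarrow> bool" where
  "block_inv Ws d g \<rho>\<^sub>0 \<mu>\<^sub>0 = (\<lambda>k (\<rho>, \<mu>).
     \<rho> rR = Suc k \<and> \<rho> rR1 = Suc (Suc k) \<and> \<rho> rPar = Suc k mod 2 \<and>
     (\<forall>y. y \<notin> block_scratch \<longrightarrow> \<rho> y = \<rho>\<^sub>0 y) \<and> \<mu> 0 = \<mu>\<^sub>0 0 \<and>
     \<mu> 2 = block_array d (Suc k) (\<mu>\<^sub>0 2) \<and>
     written (Ws @ block_productions g (\<rho>\<^sub>0 rI) (\<rho>\<^sub>0 rJ) (\<mu>\<^sub>0 2) d (Suc k)) (\<rho> rOut) (\<rho> rCnt) (\<mu> 1))"

lemma wp_block_body:
  assumes inv: "block_inv Ws d g \<rho>\<^sub>0 \<mu>\<^sub>0 k (\<rho>, \<mu>)"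
    and regs: "conj_registers d \<rho>\<^sub>0" "\<rho>\<^sub>0 rI1 = Suc (\<rho>\<^sub>0 rI)" "\<rho>\<^sub>0 rG = 2 * g + 1"
    and len: "length Ws = d + 6"
  shows "wp block_body (\<lambda>t st'. t \<le> 100 \<and> block_inv Ws d g \<rho>\<^sub>0 \<mu>\<^sub>0 (Suc k) st') (\<rho>, \<mu>)"
proof -
  have frame: "\<rho> y = \<rho>\<^sub>0 y" if "y \<notin> block_scratch" for y using inv that by (simp add: block_inv_def)
  have r: "\<rho> rR = Suc k" "\<rho> rR1 = Suc (Suc k)" "\<rho> rPar = Suc k mod 2" and
    \<mu>: "\<mu> 0 = \<mu>\<^sub>0 0" "\<mu> 2 = block_array d (Suc k) (\<mu>\<^sub>0 2)" and
    w: "written (Ws @ block_productions g (\<rho>\<^sub>0 rI) (\<rho>\<^sub>0 rJ) (\<mu>\<^sub>0 2) d (Suc k)) (\<rho> rOut) (\<rho> rCnt) (\<mu> 1)"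
    using inv by (simp_all add: block_inv_def)
  have cnt: "\<rho> rCnt = d + 6 + 2 * k" using w by (simp add: written_def length_block_productions len)
  obtain P0 P1 P2 P3 where P:
    "conj_symbols d (action_type g (\<rho>\<^sub>0 rI) (\<rho>\<^sub>0 rJ) (Suc k)) = [P0, P1, P2, P3]"
    by (cases "action_type g (\<rho>\<^sub>0 rI) (\<rho>\<^sub>0 rJ) (Suc k)") auto
  have c: "conj_registers d \<rho>" using regs(1) by (simp add: conj_registers_def frame)
  have zt: "\<rho> rZero = 0" "\<rho> rTwo = 2" "\<rho> rOne = 1" using c by (simp_all add: conj_registers_def)
  have x: "\<mu> 2 (Suc k) = \<mu>\<^sub>0 2 (Suc k)" by (simp add: \<mu> block_array_def)
  have arr: "(\<mu> 2)(Suc k := Suc (\<rho> rCnt)) = block_array d (Suc (Suc k)) (\<mu>\<^sub>0 2)"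
    using block_array_Suc[of "Suc k" d "\<mu>\<^sub>0 2"] by (simp add: \<mu> cnt)
  let ?Vs = "Ws @ block_productions g (\<rho>\<^sub>0 rI) (\<rho>\<^sub>0 rJ) (\<mu>\<^sub>0 2) d (Suc k)"
  have ext: "Ws @ block_productions g (\<rho>\<^sub>0 rI) (\<rho>\<^sub>0 rJ) (\<mu>\<^sub>0 2) d (Suc (Suc k)) =
    (?Vs @ [map NonTerm [P0, \<mu>\<^sub>0 2 (Suc k), P2]]) @ [map NonTerm [P3, Suc (\<mu>\<^sub>0 2 (Suc k)), P1]]"
    by (simp add: block_productions_Suc P letter_productions_def)
  show ?thesis
    unfolding block_body_def seqs.simps wp_simps
    \<comment> \<open>One rule for each of the three parts with a specification of their own; the instructions in
      between are executed by the simplifier.\<close>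
    apply (rule wp_choose_conj[where L = P0 and L' = P1 and M = P2 and M' = P3 and g = g, OF c])
         apply (simp_all add: r frame regs P) 
    apply (simp add: wp_simps r x)
    apply (rule wp_emit_production[where Ws = ?Vs])
        apply (use w in simp)
       apply (simp add: zt)
      apply (simp add: zt)
     apply simp
    apply simp
    apply (rule wp_emit_production[where Ws = "?Vs @ [map NonTerm [P0, \<mu>\<^sub>0 2 (Suc k), P2]]"])
        apply simp
       apply (simp add: zt)
      apply (simp add: zt)
     apply simp
    apply (simp add: wp_simps r zt)
    apply (rule wp_Cond)
     apply (auto simp: wp_simps block_inv_def frame \<mu>(1) arr[unfolded \<mu>(2)] \<mu>(2) ext r zt mod_Suc split: if_splits)
    done
qed

lemma wp_block_loop:
  assumes w: "written Ws (\<rho> rOut) (\<rho> rCnt) (\<mu> 1)" and len: "length Ws = d + 6"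
    and regs: "conj_registers d \<rho>" "\<rho> rI1 = Suc (\<rho> rI)" "\<rho> rG = 2 * g + 1" "\<rho> rStrand = s" "1 \<le> s"
    and Q: "\<And>t \<rho>' \<mu>'. t \<le> 101 * s + 3 \<Longrightarrow> (\<And>y. y \<notin> block_scratch \<Longrightarrow> \<rho>' y = \<rho> y) \<Longrightarrow> \<mu>' 0 = \<mu> 0 \<Longrightarrow>
      \<mu>' 2 = block_array d s (\<mu> 2) \<Longrightarrow>
      written (Ws @ block_productions g (\<rho> rI) (\<rho> rJ) (\<mu> 2) d s) (\<rho>' rOut) (\<rho>' rCnt) (\<mu>' 1) \<Longrightarrow>
      Q t (\<rho>', \<mu>')"
  shows "wp block_loop Q (\<rho>, \<mu>)"
proof -
  let ?\<rho> = "\<rho>(rR := 1, rR1 := 2, rPar := 1)"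
  have one: "\<rho> rOne = 1" using regs(1) by (simp add: conj_registers_def)
  have "wp (While (Less rR rStrand) block_body) (\<lambda>t. Q (1 + (1 + (1 + (t + 1))))) (?\<rho>, \<mu>)"
  proof (rule wp_While[where I = "block_inv Ws d g \<rho> \<mu>" and K = "s - 1" and T = 100])
    show "block_inv Ws d g \<rho> \<mu> 0 (?\<rho>, \<mu>)"
      using w by (auto simp: block_inv_def block_productions_1 block_array_def)
  next
    fix k and st :: state
    assume k: "k < s - 1" and inv: "block_inv Ws d g \<rho> \<mu> k st"
    obtain \<rho>' \<mu>' where st: "st = (\<rho>', \<mu>')" by fastforce
    have "test_val (Less rR rStrand) st"
      using inv k regs(4) by (simp add: st block_inv_def)
    with wp_block_body[OF inv[unfolded st] regs(1-3) len] st
    show "test_val (Less rR rStrand) st \<and>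
      wp block_body (\<lambda>t st'. t \<le> 100 \<and> block_inv Ws d g \<rho> \<mu> (Suc k) st') st" by simp
  next
    fix st assume "block_inv Ws d g \<rho> \<mu> (s - 1) st"
    then show "\<not> test_val (Less rR rStrand) st"
      using regs(4,5) by (cases st) (simp add: block_inv_def)
  next
    fix t and st :: state
    assume t: "t \<le> (s - 1) * (100 + 1) + 1" and inv: "block_inv Ws d g \<rho> \<mu> (s - 1) st"
    obtain \<rho>' \<mu>' where st: "st = (\<rho>', \<mu>')" by fastforce
    have "1 + (1 + (1 + (t + 1))) \<le> 101 * s + 3" using t regs(5) by (simp add: algebra_simps)
    then show "Q (1 + (1 + (1 + (t + 1)))) st"
      using inv regs(5) unfolding st by (intro Q) (auto simp: block_inv_def)
  qed
  then show ?thesis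
    unfolding block_loop_def seqs.simps wp_simps by (simp add: wp_simps one)
qed

definition emit_shared :: com where
  "emit_shared = seqs (map emit_production
    [[ra, rc], [rc', ra'], [ra, rc, ra', rc'], [rc, ra, rc', ra'], [ra, rc, re], [re', rc', ra']])"

lemma wp_emit_shared:
  assumes w: "written Ws (\<rho> rOut) (\<rho> rCnt) (\<mu> 1)" and zt: "\<rho> rZero = 0" "\<rho> rTwo = 2"
    and xs: "map \<rho> [ra, ra', rc, rc', re, re'] = xs"
    and Q: "\<And>t tmp out cnt B. t \<le> 200 \<Longrightarrow> written (Ws @ shared_productions xs) out cnt B \<Longrightarrow>
      Q t (\<rho>(rTmp := tmp, rOut := out, rCnt := cnt), \<mu>(1 := B))"
  shows "wp emit_shared Q (\<rho>, \<mu>)"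
proof -
  show ?thesis
    unfolding emit_shared_def
  proof (rule wp_emit_productions[where Ws = Ws])
    fix t tmp out cnt :: nat and B
    assume t: "t \<le> (\<Sum>xs\<leftarrow>[[ra, rc], [rc', ra'], [ra, rc, ra', rc'], [rc, ra, rc', ra'],
        [ra, rc, re], [re', rc', ra']]. 6 * length xs + 6) + 1"
      and "written (Ws @ map (map NonTerm) (map (map \<rho>) [[ra, rc], [rc', ra'], [ra, rc, ra', rc'],
        [rc, ra, rc', ra'], [ra, rc, re], [re', rc', ra']])) out cnt B"
    then have "written (Ws @ shared_productions xs) out cnt B"
      by (simp add: shared_productions_def xs[symmetric])
    with t show "Q t (\<rho>(rTmp := tmp, rOut := out, rCnt := cnt), \<mu>(1 := B))"
      by (intro Q) simp_all
  qed (use w zt in simp_all)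
qed

definition load_letter_symbols :: com where
  "load_letter_symbols = Cond (Eq rB rZero)
     (seqs [Load ra' 2 rJ, Copy ra ra', Inc ra, Load rc' 2 rI, Copy rc rc', Inc rc, Copy re rc', Copy re' rc])
     (seqs [Load ra 2 rI, Copy ra' ra, Inc ra', Load rc 2 rJ, Copy rc' rc, Inc rc', Copy re ra', Copy re' ra])"

definition prepare_letter :: com where
  "prepare_letter = seqs [Copy rRoot rCnt,
     Copy rD rCnt, Inc rD, Copy rD' rD, Inc rD', Copy rC rD', Inc rC, Copy rC' rC, Inc rC',
     Copy rE rC', Inc rE, Copy rE' rE, Inc rE', Copy rI1 rI, Inc rI1, load_letter_symbols]"

abbreviation "letter_scratch \<equiv> {ra, ra', rc, rc', re, re', rD, rD', rC, rC', rE, rE', rI1, rRoot}"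

lemma wp_prepare_letter:
  fixes b :: bool
  assumes b: "\<rho> rB = (if b then 1 else 0)" and zero: "\<rho> rZero = 0" "\<rho> rOne = 1" "\<rho> rTwo = 2"
    and Q: "\<And>t \<rho>'. t \<le> 50 \<Longrightarrow> (\<And>y. y \<notin> letter_scratch \<Longrightarrow> \<rho>' y = \<rho> y) \<Longrightarrow> \<rho>' rRoot = \<rho> rCnt \<Longrightarrow>
      conj_registers (\<rho> rCnt) \<rho>' \<Longrightarrow> \<rho>' rI1 = Suc (\<rho> rI) \<Longrightarrow>
      map \<rho>' [ra, ra', rc, rc', re, re'] = letter_symbols (\<mu> 2) (\<rho> rI) (\<rho> rJ) b \<Longrightarrow> Q t (\<rho>', \<mu>)"
  shows "wp prepare_letter Q (\<rho>, \<mu>)"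
  unfolding prepare_letter_def load_letter_symbols_def
proof (simp add: wp_simps, rule wp_Cond, goal_cases)
  case 1
  then have "\<not> b" using b zero by (auto split: if_splits)
  then show ?case
    by (simp add: wp_simps, intro Q) (simp_all add: conj_registers_def letter_symbols_def zero)
next
  case 2
  then have "b" using b zero by (auto split: if_splits)
  then show ?case
    by (simp add: wp_simps, intro Q) (simp_all add: conj_registers_def letter_symbols_def zero)
qed

definition base_letter_step :: com where
  "base_letter_step = seqs [prepare_letter, emit_shared, block_loop, emit_production [rRoot]]"

lemma wp_base_letter_step:
  assumes w: "written Ws (\<rho> rOut) (\<rho> rCnt) (\<mu> 1)" and fr: "frame_registers g s \<rho>" and "1 \<le> s"
    and b: "\<rho> rB = (if b then 1 else 0)"
    and Q: "\<And>t \<rho>' \<mu>'. t \<le> 101 * s + 300 \<Longrightarrow> frame_registers g s \<rho>' \<Longrightarrow>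
      \<rho>' rPtr = \<rho> rPtr \<Longrightarrow> \<rho>' rLeft = \<rho> rLeft \<Longrightarrow> \<mu>' 0 = \<mu> 0 \<Longrightarrow>
      \<mu>' 2 = block_array (length Ws) s (\<mu> 2) \<Longrightarrow>
      written (Ws @ base_letter_productions g (\<rho> rI) (\<rho> rJ) b s (\<mu> 2) (length Ws)) (\<rho>' rOut) (\<rho>' rCnt) (\<mu>' 1) \<Longrightarrow>
      Q t (\<rho>', \<mu>')"
  shows "wp base_letter_step Q (\<rho>, \<mu>)"
proof -
  let ?xs = "letter_symbols (\<mu> 2) (\<rho> rI) (\<rho> rJ) b"
  let ?d = "length Ws"
  have cnt: "\<rho> rCnt = ?d" using w by (simp add: written_def)
  have regs: "\<rho> rZero = 0" "\<rho> rOne = 1" "\<rho> rTwo = 2" "\<rho> rStrand = s" "\<rho> rG = 2 * g + 1"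
    using fr by (simp_all add: frame_registers_def)
  show ?thesis
    unfolding base_letter_step_def seqs.simps wp_simps
  proof (rule wp_prepare_letter[where b = b])
    fix c :: nat and \<rho>\<^sub>1
    assume c: "c \<le> 50" and same\<^sub>1: "\<And>y. y \<notin> letter_scratch \<Longrightarrow> \<rho>\<^sub>1 y = \<rho> y"
      and regs\<^sub>1 [simp]: "\<rho>\<^sub>1 rRoot = \<rho> rCnt" "\<rho>\<^sub>1 rI1 = Suc (\<rho> rI)"
      and conj\<^sub>1: "conj_registers (\<rho> rCnt) \<rho>\<^sub>1" and xs\<^sub>1: "map \<rho>\<^sub>1 [ra, ra', rc, rc', re, re'] = ?xs"
    have [simp]: "\<rho>\<^sub>1 rZero = 0" "\<rho>\<^sub>1 rOne = 1" "\<rho>\<^sub>1 rTwo = 2" "\<rho>\<^sub>1 rStrand = s" "\<rho>\<^sub>1 rG = 2 * g + 1"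
      "\<rho>\<^sub>1 rI = \<rho> rI" "\<rho>\<^sub>1 rJ = \<rho> rJ" "\<rho>\<^sub>1 rOut = \<rho> rOut" "\<rho>\<^sub>1 rCnt = \<rho> rCnt"
      "\<rho>\<^sub>1 rPtr = \<rho> rPtr" "\<rho>\<^sub>1 rLeft = \<rho> rLeft"
      using same\<^sub>1 regs by simp_all
    show "wp emit_shared (\<lambda>t. wp block_loop (\<lambda>t'. wp (emit_production [rRoot])
      (\<lambda>t''. Q (c + (t + (t' + (t'' + 1))))))) (\<rho>\<^sub>1, \<mu>)"
    proof (rule wp_emit_shared[where Ws = Ws and xs = ?xs])
      show "map \<rho>\<^sub>1 [ra, ra', rc, rc', re, re'] = ?xs" by (rule xs\<^sub>1)
    next
      fix t tmp out cnt :: nat and B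
      let ?\<rho>\<^sub>1 = "\<rho>\<^sub>1(rTmp := tmp, rOut := out, rCnt := cnt)" and ?\<mu>\<^sub>1 = "\<mu>(1 := B)"
      let ?Ws = "Ws @ shared_productions ?xs"
      assume t: "t \<le> 200" and w\<^sub>1: "written ?Ws out cnt B"
      show "wp block_loop (\<lambda>t'. wp (emit_production [rRoot])
        (\<lambda>t''. Q (c + (t + (t' + (t'' + 1)))))) (?\<rho>\<^sub>1, ?\<mu>\<^sub>1)"
      proof (rule wp_block_loop[where Ws = ?Ws and d = ?d and g = g and s = s])
        show "length ?Ws = ?d + 6" by (simp add: shared_productions_def)
        show "conj_registers ?d ?\<rho>\<^sub>1" using conj\<^sub>1 by (simp add: conj_registers_def cnt)
      next
        fix t' :: nat and \<rho>' :: "nat \<Rightarrow> nat" and \<mu>' :: "nat \<Rightarrow> nat \<Rightarrow> nat"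
        assume t': "t' \<le> 101 * s + 3" and same: "\<And>y. y \<notin> block_scratch \<Longrightarrow> \<rho>' y = ?\<rho>\<^sub>1 y"
          and \<mu>': "\<mu>' 0 = ?\<mu>\<^sub>1 0" "\<mu>' 2 = block_array ?d s (?\<mu>\<^sub>1 2)"
          and w\<^sub>2: "written (?Ws @ block_productions g (?\<rho>\<^sub>1 rI) (?\<rho>\<^sub>1 rJ) (?\<mu>\<^sub>1 2) ?d s)
            (\<rho>' rOut) (\<rho>' rCnt) (\<mu>' 1)"
        have [simp]: "\<rho>' rZero = 0" "\<rho>' rOne = 1" "\<rho>' rTwo = 2" "\<rho>' rStrand = s" "\<rho>' rG = 2 * g + 1"
          "\<rho>' rRoot = ?d" "\<rho>' rPtr = \<rho> rPtr" "\<rho>' rLeft = \<rho> rLeft"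
          using same by (simp_all add: cnt)
        show "wp (emit_production [rRoot]) (\<lambda>t''. Q (c + (t + (t' + (t'' + 1))))) (\<rho>', \<mu>')"
        proof (rule wp_emit_production[where Ws = "?Ws @ block_productions g (?\<rho>\<^sub>1 rI) (?\<rho>\<^sub>1 rJ) (?\<mu>\<^sub>1 2) ?d s"])
          fix t'' out' :: nat and B'
          assume t'': "t'' \<le> 6 * length [rRoot] + 6" and
            "written ((?Ws @ block_productions g (?\<rho>\<^sub>1 rI) (?\<rho>\<^sub>1 rJ) (?\<mu>\<^sub>1 2) ?d s) @
              [map NonTerm (map \<rho>' [rRoot])]) out' (Suc (\<rho>' rCnt)) B'"
          then have "written (Ws @ base_letter_productions g (\<rho> rI) (\<rho> rJ) b s (\<mu> 2) ?d) out' (Suc (\<rho>' rCnt)) B'"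
            by (simp add: base_letter_productions_def)
          then show "Q (c + (t + (t' + (t'' + 1))))
            (\<rho>'(rTmp := length [rRoot], rOut := out', rCnt := Suc (\<rho>' rCnt)), \<mu>'(1 := B'))"
            using t t' t'' c \<mu>' by (intro Q) (simp_all add: frame_registers_def)
        qed (use w\<^sub>2 in simp_all)
      qed (use w\<^sub>1 \<open>1 \<le> s\<close> in simp_all)
    qed (use w in simp_all)
  qed (use b regs in simp_all)
qed

definition strand_letter_step :: com where
  "strand_letter_step = seqs [Load rX 2 rI, Cond (Eq rB rZero) (Inc rX) Skip, Copy rRoot rCnt,
     emit_production [rX, rRoot]]"

lemma wp_strand_letter_step:
  assumes w: "written Ws (\<rho> rOut) (\<rho> rCnt) (\<mu> 1)" and fr: "frame_registers g s \<rho>"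
    and b: "\<rho> rB = (if b then 1 else 0)"
    and Q: "\<And>t \<rho>' B. t \<le> 50 \<Longrightarrow> frame_registers g s \<rho>' \<Longrightarrow> \<rho>' rPtr = \<rho> rPtr \<Longrightarrow> \<rho>' rLeft = \<rho> rLeft \<Longrightarrow>
      written (Ws @ [map NonTerm [if b then \<mu> 2 (\<rho> rI) else Suc (\<mu> 2 (\<rho> rI)), length Ws]])
        (\<rho>' rOut) (\<rho>' rCnt) B \<Longrightarrow>
      Q t (\<rho>', \<mu>(1 := B))"
  shows "wp strand_letter_step Q (\<rho>, \<mu>)"
proof -
  let ?x = "if b then \<mu> 2 (\<rho> rI) else Suc (\<mu> 2 (\<rho> rI))"
  let ?\<rho> = "\<rho>(rX := ?x, rRoot := \<rho> rCnt)"
  have cnt: "\<rho> rCnt = length Ws" using w by (simp add: written_def)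
  have regs: "\<rho> rZero = 0" "\<rho> rTwo = 2" using fr by (simp_all add: frame_registers_def)
  have emit: "wp (emit_production [rX, rRoot]) (\<lambda>t. Q (c + t)) (?\<rho>, \<mu>)" if c: "c \<le> 10" for c
  proof (rule wp_emit_production[where Ws = Ws])
    fix t out B
    assume t: "t \<le> 6 * length [rX, rRoot] + 6"
      and "written (Ws @ [map NonTerm (map ?\<rho> [rX, rRoot])]) out (Suc (?\<rho> rCnt)) B"
    then show "Q (c + t)
      (?\<rho>(rTmp := length [rX, rRoot], rOut := out, rCnt := Suc (?\<rho> rCnt)), \<mu>(1 := B))"
      using c fr by (intro Q) (simp_all add: frame_registers_def cnt)
  qed (use w regs in simp_all)
  have "wp (Cond (Eq rB rZero) (Inc rX) Skip)
      (\<lambda>t. wp (Copy rRoot rCnt) (\<lambda>t'. wp (emit_production [rX, rRoot])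
        (\<lambda>t''. Q (1 + (t + (t' + (t'' + 1)))))))  (\<rho>(rX := \<mu> 2 (\<rho> rI)), \<mu>)"
    using emit[of "Suc (Suc (Suc (Suc (Suc 0))))"] b regs
    by (intro wp_Cond) (auto simp: wp_simps split: if_splits)
  then show ?thesis
    unfolding strand_letter_step_def by (simp add: wp_simps)
qed

definition letter_step :: com where
  "letter_step = seqs [Dec rPtr, Load rB 0 rPtr, Dec rPtr, Load rJ 0 rPtr, Dec rPtr, Load rI 0 rPtr,
     Dec rLeft,
     Cond (Less rJ rStrand) base_letter_step (Cond (Eq rJ rStrand) strand_letter_step Skip)]"

definition input_letters :: "(nat \<times> nat) letter list \<Rightarrow> (nat \<Rightarrow> nat) \<Rightarrow> bool" where
  "input_letters w B \<longleftrightarrow> (\<forall>q<length w. B (5 + 3 * q) = fst (fst (w ! q)) \<and>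
     B (6 + 3 * q) = snd (fst (w ! q)) \<and> B (7 + 3 * q) = (if snd (w ! q) then 1 else 0))"

lemma length_encode_letters: "length (concat (map encode_letter w)) = 3 * length w"
  by (induction w) auto

lemma nth_encode_letters:
  "q < length w \<Longrightarrow> concat (map encode_letter w) ! (3 * q) = fst (fst (w ! q)) \<and>
    concat (map encode_letter w) ! (3 * q + 1) = snd (fst (w ! q)) \<and>
    concat (map encode_letter w) ! (3 * q + 2) = (if snd (w ! q) then 1 else 0)"
proof (induction w arbitrary: q)
  case (Cons l w)
  obtain i j b where l: "l = ((i, j), b)" by (metis prod.exhaust)
  show ?case
  proof (cases q)
    case 0
    then show ?thesis by (simp add: l)
  next
    case (Suc q')
    then show ?thesis using Cons.IH[of q'] Cons.prems by (simp add: l)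
  qed
qed simp

lemma input_letters_initial:
  "input_letters w (snd (initial_state (encode_input g p n k w)) 0)"
  using nth_encode_letters[of _ w] length_encode_letters[of w]
  by (auto simp: input_letters_def initial_state_def encode_input_def nth_append)

text \<open>The state after the last \<open>k\<close> letters of \<open>w\<close> have been read; \<open>2 * (s - 1)\<close> counts the initial
productions.\<close>

definition letter_inv where
  "letter_inv g p n s w k = (\<lambda>(\<rho>, \<mu> :: nat \<Rightarrow> nat \<Rightarrow> nat). frame_registers g s \<rho> \<and> \<rho> rLeft = length w - k \<and>
     \<rho> rPtr = 5 + 3 * (length w - k) \<and> input_letters w (\<mu> 0) \<and>
     (\<exists>Ws. written Ws (\<rho> rOut) (\<rho> rCnt) (\<mu> 1) \<and> tracks g p n s (drop (length w - k) w) Ws (\<mu> 2) \<and>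
       compressed_size Ws \<le> 2 * (s - 1) + k * (6 * (s - 1) + 19)))"

lemma wp_letter_step:
  assumes inv: "letter_inv g p n s w k (\<rho>, \<mu>)" and k: "k < length w"
    and w: "w \<in> words (gens g p n)"
    and s: "\<And>r. 1 \<le> r \<Longrightarrow> r < s \<Longrightarrow> (r, s) \<in> gens g p n" and "1 \<le> s"
  shows "wp letter_step (\<lambda>t st'. t \<le> 101 * s + 320 \<and> letter_inv g p n s w (Suc k) st') (\<rho>, \<mu>)"
proof -
  define q where "q = length w - Suc k"
  have q: "length w - k = Suc q" "q < length w" using k by (simp_all add: q_def)
  obtain i j b where l: "w ! q = ((i, j), b)" by (metis prod.exhaust)
  have drop: "drop q w = ((i, j), b) # drop (Suc q) w" using q by (simp add: Cons_nth_drop_Suc flip: l)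
  have "w ! q \<in> gens g p n \<times> UNIV" using w nth_mem[OF q(2)] by auto
  then have ij: "(i, j) \<in> gens g p n" unfolding l by simp
  obtain Ws where fr: "frame_registers g s \<rho>" "\<rho> rLeft = Suc q" "\<rho> rPtr = 5 + 3 * Suc q"
    and inp: "input_letters w (\<mu> 0)" and wr: "written Ws (\<rho> rOut) (\<rho> rCnt) (\<mu> 1)"
    and tr: "tracks g p n s (drop (Suc q) w) Ws (\<mu> 2)"
    and size: "compressed_size Ws \<le> 2 * (s - 1) + k * (6 * (s - 1) + 19)"
    using inv by (auto simp: letter_inv_def q)
  have inp': "\<mu> 0 (5 + 3 * q) = i" "\<mu> 0 (6 + 3 * q) = j" "\<mu> 0 (7 + 3 * q) = (if b then 1 else 0)"
    using inp q l by (simp_all add: input_letters_def)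
  let ?\<rho> = "\<rho>(rB := if b then 1 else 0, rJ := j, rPtr := 5 + 3 * q, rI := i, rLeft := q)"
  have fr': "frame_registers g s ?\<rho>" using fr(1) by (simp add: frame_registers_def)
  have strand: "?\<rho> rStrand = s" using fr by (simp add: frame_registers_def)
  have invI: "letter_inv g p n s w (Suc k) (\<rho>', \<mu>')"
    if "frame_registers g s \<rho>'" "\<rho>' rLeft = q" "\<rho>' rPtr = 5 + 3 * q" "\<mu>' 0 = \<mu> 0"
      "written (Ws @ Vs) (\<rho>' rOut) (\<rho>' rCnt) (\<mu>' 1)" "tracks g p n s (drop q w) (Ws @ Vs) (\<mu>' 2)"
      "compressed_size Vs \<le> 6 * (s - 1) + 19" for \<rho>' \<mu>' Vs
  proof -
    have "compressed_size (Ws @ Vs) \<le> 2 * (s - 1) + Suc k * (6 * (s - 1) + 19)"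
      using that(7) size by simp
    then show ?thesis unfolding letter_inv_def using that inp by (auto simp: q_def[symmetric])
  qed
  have "wp (Cond (Less rJ rStrand) base_letter_step (Cond (Eq rJ rStrand) strand_letter_step Skip))
    (\<lambda>t st'. 7 + (t + 1) \<le> 101 * s + 320 \<and> letter_inv g p n s w (Suc k) st') (?\<rho>, \<mu>)"
  proof (rule wp_Cond)
    assume "test_val (Less rJ rStrand) (?\<rho>, \<mu>)"
    then have "j < s" using strand by simp
    show "wp base_letter_step (\<lambda>t st'. 7 + (t + 1 + 1) \<le> 101 * s + 320 \<and>
      letter_inv g p n s w (Suc k) st') (?\<rho>, \<mu>)"
    proof (rule wp_base_letter_step[where Ws = Ws and b = b, OF _ fr' \<open>1 \<le> s\<close>])
      fix t :: nat and \<rho>' :: "nat \<Rightarrow> nat" and \<mu>' :: "nat \<Rightarrow> nat \<Rightarrow> nat"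
      let ?Vs = "base_letter_productions g (?\<rho> rI) (?\<rho> rJ) b s (\<mu> 2) (length Ws)"
      assume t: "t \<le> 101 * s + 300" "frame_registers g s \<rho>'" "\<rho>' rPtr = ?\<rho> rPtr"
        "\<rho>' rLeft = ?\<rho> rLeft" "\<mu>' 0 = \<mu> 0" and \<mu>': "\<mu>' 2 = block_array (length Ws) s (\<mu> 2)"
        and wr': "written (Ws @ ?Vs) (\<rho>' rOut) (\<rho>' rCnt) (\<mu>' 1)"
      have "tracks g p n s (drop q w) (Ws @ ?Vs) (\<mu>' 2)"
        using tracks_base_letter[OF tr ij \<open>j < s\<close> s, of b] unfolding drop \<mu>'
        by (subst tracks_cong[where f' = "\<lambda>r. length Ws + 5 + 2 * r"]) (simp_all add: block_array_def)
      with t wr' show "7 + (t + 1 + 1) \<le> 101 * s + 320 \<and> letter_inv g p n s w (Suc k) (\<rho>', \<mu>')"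
        by (intro conjI invI[where Vs = ?Vs])
          (simp_all add: compressed_size_base_letter[OF \<open>1 \<le> s\<close>])
    qed (use wr in simp_all)
  next
    assume "\<not> test_val (Less rJ rStrand) (?\<rho>, \<mu>)"
    then have "s \<le> j" using strand by simp
    show "wp (Cond (Eq rJ rStrand) strand_letter_step Skip)
      (\<lambda>t st'. 7 + (t + 1 + 1) \<le> 101 * s + 320 \<and> letter_inv g p n s w (Suc k) st') (?\<rho>, \<mu>)"
    proof (rule wp_Cond)
      assume "test_val (Eq rJ rStrand) (?\<rho>, \<mu>)"
      then have j: "j = s" using strand by simp
      show "wp strand_letter_step (\<lambda>t st'. 7 + (t + 1 + 1 + 1) \<le> 101 * s + 320 \<and>
        letter_inv g p n s w (Suc k) st') (?\<rho>, \<mu>)"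
      proof (rule wp_strand_letter_step[where Ws = Ws and b = b, OF _ fr'])
        fix t :: nat and \<rho>' :: "nat \<Rightarrow> nat" and B
        let ?Vs = "[map NonTerm [if b then \<mu> 2 (?\<rho> rI) else Suc (\<mu> 2 (?\<rho> rI)), length Ws]]"
        assume "t \<le> 50" "frame_registers g s \<rho>'" "\<rho>' rPtr = ?\<rho> rPtr" "\<rho>' rLeft = ?\<rho> rLeft"
          "written (Ws @ ?Vs) (\<rho>' rOut) (\<rho>' rCnt) B"
        moreover have "tracks g p n s (drop q w) (Ws @ ?Vs) (\<mu> 2)"
          using tracks_strand_letter[OF tr, of i b] ij
          unfolding drop j by (cases b) (simp_all add: gens_def)
        ultimately show "7 + (t + 1 + 1 + 1) \<le> 101 * s + 320 \<and>
            letter_inv g p n s w (Suc k) (\<rho>', \<mu>(1 := B))"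
          by (intro conjI invI[where Vs = ?Vs]) simp_all
      qed (use wr in simp_all)
    next
      assume "\<not> test_val (Eq rJ rStrand) (?\<rho>, \<mu>)"
      then have "s < j" using strand \<open>s \<le> j\<close> by simp
      then show "wp Skip (\<lambda>t st'. 7 + (t + 1 + 1 + 1) \<le> 101 * s + 320 \<and>
        letter_inv g p n s w (Suc k) st') (?\<rho>, \<mu>)"
        using fr' wr tracks_skip[OF tr, of j i b] unfolding wp_simps drop[symmetric]
        by (intro conjI invI[where Vs = "[]"]) simp_all
    qed
  qed
  then show ?thesis
    unfolding letter_step_def
    using fr inp' by (cases b) (simp_all add: wp_simps fun_upd_twist)
qed

section \<open>The combing program and the bounds\<close>

text \<open>The two productions for $x_r$ and $x_r^{-1}$ are single terminals, written as one list of numbers.\<close>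

definition init_body :: com where
  "init_body = seqs [Copy rTmp rCnt, Inc rTmp, Store 2 rR rTmp,
     emits [rOne, rR, rStrand, rOne, rOne, rR, rStrand, rZero], Inc rCnt, Inc rCnt, Inc rR]"

definition init_inv where
  "init_inv s \<rho>\<^sub>0 \<mu>\<^sub>0 k = (\<lambda>(\<rho>, \<mu> :: nat \<Rightarrow> nat \<Rightarrow> nat). \<rho> rR = Suc k \<and>
     (\<forall>y. y \<notin> {rR, rTmp, rOut, rCnt} \<longrightarrow> \<rho> y = \<rho>\<^sub>0 y) \<and> \<mu> 0 = \<mu>\<^sub>0 0 \<and>
     (\<forall>r. 1 \<le> r \<and> r < Suc k \<longrightarrow> \<mu> 2 r = 2 * r) \<and>
     written (init_productions s (Suc k)) (\<rho> rOut) (\<rho> rCnt) (\<mu> 1))"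

lemma wp_init_body:
  assumes inv: "init_inv s \<rho>\<^sub>0 \<mu>\<^sub>0 k (\<rho>, \<mu>)" and fr: "frame_registers g s \<rho>\<^sub>0"
  shows "wp init_body (\<lambda>t st'. t \<le> 50 \<and> init_inv s \<rho>\<^sub>0 \<mu>\<^sub>0 (Suc k) st') (\<rho>, \<mu>)"
proof -
  have regs: "\<rho> rZero = 0" "\<rho> rOne = 1" "\<rho> rStrand = s" "\<rho> rR = Suc k"
    using inv fr by (simp_all add: init_inv_def frame_registers_def)
  have wr: "written (init_productions s (Suc k)) (\<rho> rOut) (\<rho> rCnt) (\<mu> 1)"
    using inv by (simp add: init_inv_def)
  then have cnt: "\<rho> rCnt = Suc (2 * k)" by (simp add: written_def length_init_productions)
  let ?\<rho> = "\<rho>(rTmp := Suc (\<rho> rCnt))" and ?\<mu> = "\<mu>(2 := (\<mu> 2)(Suc k := Suc (\<rho> rCnt)))"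
  have "wp (emits [rOne, rR, rStrand, rOne, rOne, rR, rStrand, rZero])
    (\<lambda>t. wp (Inc rCnt) (\<lambda>t'. wp (Inc rCnt) (\<lambda>t''. wp (Inc rR)
       (\<lambda>u st'. 3 + (t + (t' + (t'' + (u + 1)))) \<le> 50 \<and> init_inv s \<rho>\<^sub>0 \<mu>\<^sub>0 (Suc k) st'))))
    (?\<rho>, ?\<mu>)"
  proof (rule wp_emits[where E = "concat (map encode_production (init_productions s (Suc k)))"])
    show "written_list (concat (map encode_production (init_productions s (Suc k)))) (?\<rho> rOut) (?\<mu> 1)"
      using wr by (simp add: written_def)
  next
    fix t out :: nat and B
    assume t: "t \<le> 2 * length [rOne, rR, rStrand, rOne, rOne, rR, rStrand, rZero] + 1"
      and "written_list (concat (map encode_production (init_productions s (Suc k))) @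
        map ?\<rho> [rOne, rR, rStrand, rOne, rOne, rR, rStrand, rZero]) out B"
    then have "written (init_productions s (Suc (Suc k))) out (Suc (Suc (\<rho> rCnt))) B"
      using wr regs by (simp add: written_def init_productions_Suc encode_production_def)
    then show "wp (Inc rCnt) (\<lambda>t'. wp (Inc rCnt) (\<lambda>t''. wp (Inc rR)
       (\<lambda>u st'. 3 + (t + (t' + (t'' + (u + 1)))) \<le> 50 \<and> init_inv s \<rho>\<^sub>0 \<mu>\<^sub>0 (Suc k) st')))
       (?\<rho>(rOut := out), ?\<mu>(1 := B))"
      using t inv regs by (simp add: wp_simps init_inv_def cnt less_Suc_eq)
  qed simp
  then show ?thesis
    unfolding init_body_def by (simp add: wp_simps regs)
qed

definition init_and_main :: com where
  "init_and_main = seqs [Set rR 1, While (Less rR rStrand) init_body, emit_production [],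
     While (Less rZero rLeft) letter_step]"

lemma wp_init_and_main:
  assumes fr: "frame_registers g s \<rho>" and wr: "written [[]] (\<rho> rOut) (\<rho> rCnt) (\<mu> 1)"
    and inp: "\<rho> rLeft = length w" "\<rho> rPtr = 5 + 3 * length w" "input_letters w (\<mu> 0)"
    and w: "w \<in> words (gens g p n)"
    and s: "\<And>r. 1 \<le> r \<Longrightarrow> r < s \<Longrightarrow> (r, s) \<in> gens g p n" and "1 \<le> s"
    and Q: "\<And>t st'. t \<le> 51 * s + length w * (101 * s + 321) + 20 \<Longrightarrow>
      letter_inv g p n s w (length w) st' \<Longrightarrow> Q t st'"
  shows "wp init_and_main Q (\<rho>, \<mu>)"
proof -
  have "wp (While (Less rR rStrand) init_body) (\<lambda>t. wp (emit_production [])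
      (\<lambda>t'. wp (While (Less rZero rLeft) letter_step) (\<lambda>t''. Q (1 + (t + (t' + (t'' + 1)))))))
      (\<rho>(rR := 1), \<mu>)"
  proof (rule wp_While[where I = "init_inv s \<rho> \<mu>" and K = "s - 1" and T = 50])
    show "init_inv s \<rho> \<mu> 0 (\<rho>(rR := 1), \<mu>)"
      using wr by (simp add: init_inv_def init_productions_def)
  next
    fix k and st :: state
    assume k: "k < s - 1" and inv: "init_inv s \<rho> \<mu> k st"
    obtain \<rho>' \<mu>' where st: "st = (\<rho>', \<mu>')" by fastforce
    have "test_val (Less rR rStrand) st"
      using inv k fr by (simp add: st init_inv_def frame_registers_def)
    then show "test_val (Less rR rStrand) st \<and>
        wp init_body (\<lambda>t st'. t \<le> 50 \<and> init_inv s \<rho> \<mu> (Suc k) st') st"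
      using wp_init_body[OF inv[unfolded st] fr] st by simp
  next
    fix st assume "init_inv s \<rho> \<mu> (s - 1) st"
    then show "\<not> test_val (Less rR rStrand) st"
      using fr \<open>1 \<le> s\<close> by (cases st) (simp add: init_inv_def frame_registers_def)
  next
    fix t and st :: state
    assume t: "t \<le> (s - 1) * (50 + 1) + 1" and inv: "init_inv s \<rho> \<mu> (s - 1) st"
    obtain \<rho>' \<mu>' where st: "st = (\<rho>', \<mu>')" by fastforce
    have t_le: "t \<le> 51 * s + 1" using t by (simp add: algebra_simps)
    have same: "\<rho>' y = \<rho> y" if "y \<notin> {rR, rTmp, rOut, rCnt}" for y
      using inv that by (simp add: st init_inv_def)
    have \<mu>': "\<mu>' 0 = \<mu> 0" "\<And>r. 1 \<le> r \<Longrightarrow> r < s \<Longrightarrow> \<mu>' 2 r = 2 * r"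
      and wr': "written (init_productions s s) (\<rho>' rOut) (\<rho>' rCnt) (\<mu>' 1)"
      using inv \<open>1 \<le> s\<close> by (simp_all add: st init_inv_def)
    have fr': "frame_registers g s \<rho>'" using fr same by (simp add: frame_registers_def)
    show "wp (emit_production []) (\<lambda>t'. wp (While (Less rZero rLeft) letter_step)
        (\<lambda>t''. Q (1 + (t + (t' + (t'' + 1)))))) st"
      unfolding st
    proof (rule wp_emit_production[where Ws = "init_productions s s"])
      fix t' out :: nat and B
      let ?\<rho> = "\<rho>'(rTmp := length ([] :: nat list), rOut := out, rCnt := Suc (\<rho>' rCnt))"
      assume t': "t' \<le> 6 * length ([] :: nat list) + 6" and
        wr'': "written (init_productions s s @ [map NonTerm (map \<rho>' [])]) out (Suc (\<rho>' rCnt)) B"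
      show "wp (While (Less rZero rLeft) letter_step) (\<lambda>t''. Q (1 + (t + (t' + (t'' + 1)))))
        (?\<rho>, \<mu>'(1 := B))"
      proof (rule wp_While[where I = "letter_inv g p n s w" and K = "length w" and T = "101 * s + 320"])
        have "tracks g p n s [] (init_productions s s @ [[]]) (\<mu>' 2)"
          using init_tracks[OF s \<open>1 \<le> s\<close>] \<mu>'(2)
          by (subst tracks_cong[where f' = "\<lambda>r. 2 * r"]) simp_all
        then show "letter_inv g p n s w 0 (?\<rho>, \<mu>'(1 := B))"
          using fr' wr'' inp same \<mu>'(1) \<open>1 \<le> s\<close>
          by (auto simp: letter_inv_def frame_registers_def compressed_size_init
              intro!: exI[of _ "init_productions s s @ [[]]"])
      next
        fix k and st :: state
        assume k: "k < length w" and inv: "letter_inv g p n s w k st"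
        obtain \<rho>'' \<mu>'' where st: "st = (\<rho>'', \<mu>'')" by fastforce
        have "test_val (Less rZero rLeft) st"
          using inv k by (simp add: st letter_inv_def frame_registers_def)
        then show "test_val (Less rZero rLeft) st \<and>
            wp letter_step (\<lambda>t st'. t \<le> 101 * s + 320 \<and> letter_inv g p n s w (Suc k) st') st"
          using wp_letter_step[OF inv[unfolded st] k w s \<open>1 \<le> s\<close>] st by simp
      next
        fix st assume "letter_inv g p n s w (length w) st"
        then show "\<not> test_val (Less rZero rLeft) st"
          by (cases st) (simp add: letter_inv_def frame_registers_def)
      next
        fix t'' and st :: state
        assume "t'' \<le> length w * (101 * s + 320 + 1) + 1" "letter_inv g p n s w (length w) st"
        then show "Q (1 + (t + (t' + (t'' + 1)))) st"
          using t_le t' by (intro Q) (simp_all add: algebra_simps)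
      qed
    qed (use wr' fr' in \<open>simp_all add: frame_registers_def\<close>)
  qed
  then show ?thesis unfolding init_and_main_def by (simp add: wp_simps)
qed

lemma wp_increments:
  "wp (seqs (map Inc xs)) Q (\<rho>, \<mu>) \<longleftrightarrow> Q (length xs + 1) (\<lambda>y. \<rho> y + count_list xs y, \<mu>)"
proof (induction xs arbitrary: Q \<rho>)
  case (Cons x xs)
  have "(\<lambda>y. (\<rho>(x := Suc (\<rho> x))) y + count_list xs y) = (\<lambda>y. \<rho> y + count_list (x # xs) y)"
    by auto
  then show ?case using Cons.IH by (simp add: wp_simps)
qed (simp add: wp_simps)

text \<open>Multiplication by repeated increments: a loop that runs \<open>n\<close> times increments each register by \<open>n\<close> times
its number of occurrences in \<open>xs\<close>, where \<open>c\<close> occurs once and counts the rounds.\<close>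

lemma wp_counting_loop:
  assumes "\<rho> c = 0" "count_list xs c = 1" "n \<notin> set xs"
    and Q: "\<And>t. t \<le> \<rho> n * (length xs + 2) + 1 \<Longrightarrow> Q t (\<lambda>y. \<rho> y + \<rho> n * count_list xs y, \<mu>)"
  shows "wp (While (Less c n) (seqs (map Inc xs))) Q (\<rho>, \<mu>)"
proof (rule wp_While[where I = "\<lambda>k st. st = (\<lambda>y. \<rho> y + k * count_list xs y, \<mu>)"
      and K = "\<rho> n" and T = "length xs + 1"])
  fix k and st :: state
  assume "k < \<rho> n" "st = (\<lambda>y. \<rho> y + k * count_list xs y, \<mu>)"
  then show "test_val (Less c n) st \<and> wp (seqs (map Inc xs)) (\<lambda>t st'. t \<le> length xs + 1 \<and>
      st' = (\<lambda>y. \<rho> y + Suc k * count_list xs y, \<mu>)) st"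
    using assms(1-3) by (auto simp: wp_increments)
next
  fix t and st :: state
  assume "t \<le> \<rho> n * (length xs + 1 + 1) + 1" "st = (\<lambda>y. \<rho> y + \<rho> n * count_list xs y, \<mu>)"
  then show "Q t st" using Q by simp
qed (use assms(1-3) in auto)

definition load_input :: com where
  "load_input = seqs [Set rOne 1, Set rTwo 2, Load rGenus 0 rZero, Load rBound 0 rOne,
     Set rTmp 3, Load rStrand 0 rTmp, Set rTmp 4, Load rLeft 0 rTmp, Set rPtr 5, Set rG 1, Set rOut 1]"

text \<open>Computes $s = 2g + p + k - 1$, the bound $2g + 1$ and the position $5 + 3m$ behind the input.\<close>

definition compute_indices :: com where
  "compute_indices = seqs [
     While (Less rK rGenus) (seqs (map Inc [rStrand, rStrand, rG, rG, rK])),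
     Set rK 0, While (Less rK rBound) (seqs (map Inc [rStrand, rK])),
     Set rK 0, While (Less rK rLeft) (seqs (map Inc [rPtr, rPtr, rPtr, rK])),
     Dec rStrand]"

lemma wp_load_input:
  assumes inp: "\<mu> 0 0 = g" "\<mu> 0 1 = p" "\<mu> 0 3 = k" "\<mu> 0 4 = m"
    and Q: "\<And>t \<rho>. t \<le> 20 \<Longrightarrow> \<rho> rZero = 0 \<Longrightarrow> \<rho> rOne = 1 \<Longrightarrow> \<rho> rTwo = 2 \<Longrightarrow> \<rho> rGenus = g \<Longrightarrow> \<rho> rBound = p \<Longrightarrow>
      \<rho> rStrand = k \<Longrightarrow> \<rho> rLeft = m \<Longrightarrow> \<rho> rPtr = 5 \<Longrightarrow> \<rho> rG = 1 \<Longrightarrow> \<rho> rOut = 1 \<Longrightarrow> \<rho> rCnt = 0 \<Longrightarrow>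
      \<rho> rK = 0 \<Longrightarrow> Q t (\<rho>, \<mu>)"
  shows "wp load_input Q (\<lambda>_. 0, \<mu>)"
  using inp by (simp add: load_input_def wp_simps) (rule Q; simp)

lemma wp_compute_indices:
  assumes \<rho>: "\<rho> rGenus = g" "\<rho> rBound = p" "\<rho> rStrand = k" "\<rho> rLeft = m" "\<rho> rPtr = 5" "\<rho> rG = 1" "\<rho> rK = 0"
    and Q: "\<And>t \<rho>'. t \<le> 7 * g + 4 * p + 6 * m + 10 \<Longrightarrow> \<rho>' rStrand = k + 2 * g + p - 1 \<Longrightarrow>
      \<rho>' rG = 2 * g + 1 \<Longrightarrow> \<rho>' rPtr = 5 + 3 * m \<Longrightarrow>
      (\<And>y. y \<notin> {rStrand, rG, rPtr, rK} \<Longrightarrow> \<rho>' y = \<rho> y) \<Longrightarrow> Q t (\<rho>', \<mu>)"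
  shows "wp compute_indices Q (\<rho>, \<mu>)"
  unfolding compute_indices_def seqs.simps wp_simps
proof (rule wp_counting_loop, goal_cases)
  case (4 t)
  show ?case
    unfolding wp_simps
  proof (rule wp_counting_loop, goal_cases)
    case (4 t')
    show ?case
      unfolding wp_simps
    proof (rule wp_counting_loop, goal_cases)
      case (4 t'')
      show ?case
        using \<open>t \<le> _\<close> \<open>t' \<le> _\<close> \<open>t'' \<le> _\<close> \<rho> unfolding wp_simps by (intro Q) simp_all
    qed (use \<rho> in simp_all)
  qed (use \<rho> in simp_all)
qed (use \<rho> in simp_all)

text \<open>For the empty word nothing but one empty production is written, since the size must then be 0 and
the initial productions would exceed it.\<close>

definition combing_program :: com where
  "combing_program = seqs [load_input, compute_indices, emit_production [],
     Cond (Less rZero rLeft) init_and_main Skip, Store 1 rZero rCnt]"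

lemma combing_program_correct:
  assumes p: "p > 0" and k: "1 \<le> k" "k \<le> n" and w: "w \<in> words (gens g p n)"
  defines "s \<equiv> strand_index g p k"
  shows "wp combing_program (\<lambda>t st. \<exists>Ws.
      t \<le> 7 * g + 4 * p + 6 * length w + 51 * s + length w * (101 * s + 321) + 100 \<and>
      has_output st (encode_compressed Ws) \<and> compressed_word (strand_letters s) Ws \<and>
      compressed_size Ws \<le> (if w = [] then 0 else 2 * (s - 1) + length w * (6 * (s - 1) + 19)) \<and>
      braid_eq g p n (ev Ws) (factor_word g p k w))
    (initial_state (encode_input g p n k w))"
    (is "wp _ ?Q _")
proof -
  define \<mu> where "\<mu> = snd (initial_state (encode_input g p n k w))"
  have init: "initial_state (encode_input g p n k w) = (\<lambda>_. 0, \<mu>)"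
    by (simp add: \<mu>_def initial_state_def)
  have s: "1 \<le> s" using k by (simp add: s_def strand_index_def)
  have gens: "\<And>r. 1 \<le> r \<Longrightarrow> r < s \<Longrightarrow> (r, s) \<in> gens g p n"
    using strand_gens[OF p k] by (simp add: s_def)
  have input: "input_letters w (\<mu> 0)" unfolding \<mu>_def by (rule input_letters_initial)
  show ?thesis
    unfolding init combing_program_def seqs.simps wp_simps
  proof (rule wp_load_input[where g = g and p = p and k = k and m = "length w"], goal_cases)
    case (5 u\<^sub>0 \<rho>\<^sub>0)
    note \<rho>\<^sub>0 = 5
    show ?case
    proof (rule wp_compute_indices[where g = g and p = p and k = k and m = "length w"])
      fix t\<^sub>0 and \<rho> :: "nat \<Rightarrow> nat"
      assume t\<^sub>0: "t\<^sub>0 \<le> 7 * g + 4 * p + 6 * length w + 10" and strand: "\<rho> rStrand = k + 2 * g + p - 1"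
        and "\<rho> rG = 2 * g + 1" "\<rho> rPtr = 5 + 3 * length w"
        and same: "\<And>y. y \<notin> {rStrand, rG, rPtr, rK} \<Longrightarrow> \<rho> y = \<rho>\<^sub>0 y"
      have "\<rho> rStrand = s" using strand p by (simp add: s_def strand_index_def)
      then have fr: "frame_registers g (strand_index g p k) \<rho>" and
        \<rho>: "\<rho> rLeft = length w" "\<rho> rPtr = 5 + 3 * length w" "\<rho> rOut = 1" "\<rho> rCnt = 0"
        using \<rho>\<^sub>0 same \<open>\<rho> rG = _\<close> \<open>\<rho> rPtr = _\<close> by (simp_all add: frame_registers_def s_def)
      define t where "t = u\<^sub>0 + t\<^sub>0"
      have t: "t \<le> 7 * g + 4 * p + 6 * length w + 30" using t\<^sub>0 \<rho>\<^sub>0(1) by (simp add: t_def)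
      have "wp (emit_production []) (\<lambda>t'. wp (Cond (Less rZero rLeft) init_and_main Skip)
         (\<lambda>t''. wp (Store 1 rZero rCnt) (\<lambda>u. ?Q (t + (t' + (t'' + (u + 1))))))) (\<rho>, \<mu>)"
      proof (rule wp_emit_production[where Ws = "[]"])
        fix t' out :: nat and B
        let ?\<rho> = "\<rho>(rTmp := length ([] :: nat list), rOut := out, rCnt := Suc (\<rho> rCnt))"
        assume t': "t' \<le> 6 * length ([] :: nat list) + 6" and
          wr: "written ([] @ [map NonTerm (map \<rho> [])]) out (Suc (\<rho> rCnt)) B"
        show "wp (Cond (Less rZero rLeft) init_and_main Skip)
         (\<lambda>t''. wp (Store 1 rZero rCnt) (\<lambda>u. ?Q (t + (t' + (t'' + (u + 1)))))) (?\<rho>, \<mu>(1 := B))"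
        proof (rule wp_Cond)
          assume "test_val (Less rZero rLeft) (?\<rho>, \<mu>(1 := B))"
          then have "w \<noteq> []" using \<rho> by auto
          show "wp init_and_main (\<lambda>t''. wp (Store 1 rZero rCnt) (\<lambda>u. ?Q (t + (t' + (t'' + 1 + (u + 1))))))
            (?\<rho>, \<mu>(1 := B))"
          proof (rule wp_init_and_main[where g = g and p = p and n = n and s = s and w = w, OF _ _ _ _ _ w gens s])
            fix t'' and st :: state
            assume t'': "t'' \<le> 51 * s + length w * (101 * s + 321) + 20"
              and inv: "letter_inv g p n s w (length w) st"
            obtain \<rho>' \<mu>' where st: "st = (\<rho>', \<mu>')" by fastforce
            obtain Ws where zero: "\<rho>' rZero = 0" and wr: "written Ws (\<rho>' rOut) (\<rho>' rCnt) (\<mu>' 1)"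
              and tr: "tracks g p n s w Ws (\<mu>' 2)"
              and size: "compressed_size Ws \<le> 2 * (s - 1) + length w * (6 * (s - 1) + 19)"
              using inv by (auto simp: st letter_inv_def frame_registers_def)
            have "compressed_word (strand_letters s) Ws" using tr by (simp add: tracks_def)
            then show "wp (Store 1 rZero rCnt) (\<lambda>u. ?Q (t + (t' + (t'' + 1 + (u + 1))))) st"
              using t t' t'' size \<open>w \<noteq> []\<close> has_output_written[of Ws "\<rho>' rOut" "\<rho>' rCnt" \<mu>' \<rho>', OF wr] tracks_ev(2)[OF tr[unfolded s_def] k(1)]
              unfolding st wp_simps zero by (intro exI[of _ Ws] conjI) simp_all
          qed (use fr wr \<rho> input in \<open>simp_all add: frame_registers_def s_def\<close>)
        next
          assume "\<not> test_val (Less rZero rLeft) (?\<rho>, \<mu>(1 := B))"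
          then have nil: "w = []" using \<rho> fr by (simp add: frame_registers_def)
          have cw: "compressed_word (strand_letters s) [[]]"
            using finite_strand_letters[of s] by (simp add: compressed_word_iff syms_below_def)
          have "ev [[]] = ([] :: (nat \<times> nat) letter list)" by (simp add: ev_def replace_nonterm_def)
          then have "braid_eq g p n (ev [[]]) (factor_word g p k w)"
            by (simp add: nil factor_word_def pres_eq.refl)
          moreover have "has_output (\<rho>', (\<mu>(1 := B))(1 := ((\<mu>(1 := B)) 1)(0 := Suc (\<rho> rCnt))))
              (encode_compressed [[]])" for \<rho>'
            using wr by (intro has_output_written) simp
          ultimately show "wp Skip (\<lambda>t''. wp (Store 1 rZero rCnt)
              (\<lambda>u. ?Q (t + (t' + (t'' + 1 + (u + 1)))))) (?\<rho>, \<mu>(1 := B))"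
            using cw t t' fr unfolding wp_simps
            by (intro exI[of _ "[[]]"] conjI) (simp_all add: nil frame_registers_def)
        qed
      qed (use fr \<rho> in \<open>simp_all add: frame_registers_def written_def written_list_def\<close>)
      then show "wp (emit_production []) (\<lambda>t'. wp (Cond (Less rZero rLeft) init_and_main Skip)
         (\<lambda>t''. wp (Store 1 rZero rCnt) (\<lambda>u. ?Q (u\<^sub>0 + (t\<^sub>0 + (t' + (t'' + (u + 1)))))))) (\<rho>, \<mu>)"
        by (simp only: t_def add.assoc)
    qed (use \<rho>\<^sub>0 in simp_all)
  qed (simp_all add: \<mu>_def initial_state_def encode_input_def numeral_eq_Suc)
qed

theorem theorem5p2:
  "\<exists>(prog :: com) (C :: nat). \<forall>(g :: nat) (p :: nat) (n :: nat) (k :: nat)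
      (w :: (nat \<times> nat) letter list).
    p > 0 \<longrightarrow> 1 \<le> k \<longrightarrow> k \<le> n \<longrightarrow> w \<in> words (gens g p n) \<longrightarrow>
    (\<exists>t s \<AA>.
      runs prog (initial_state (encode_input g p n k w)) t s \<and>
      t \<le> C * ((g + p + n) * max 1 (length w)) \<and>
      has_output s (encode_compressed \<AA>) \<and>
      compressed_word {((i, strand_index g p k), b) | i b. 1 \<le> i \<and> i < strand_index g p k} \<AA> \<and>
      compressed_size \<AA> \<le> 19 * (2*g + p + n) * length w \<and>
      braid g p n (ev \<AA>) = combed_factor g p n k (braid g p n w))"
proof (rule exI[of _ combing_program], rule exI[of _ 1000], intro allI impI)
  fix g p n k :: nat and w :: "(nat \<times> nat) letter list"
  assume p: "p > 0" and k: "1 \<le> k" "k \<le> n" and w: "w \<in> words (gens g p n)"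
  let ?s = "strand_index g p k" and ?L = "g + p + n" and ?m = "length w"
  obtain t st Ws where run: "runs combing_program (initial_state (encode_input g p n k w)) t st"
    and t: "t \<le> 7 * g + 4 * p + 6 * ?m + 51 * ?s + ?m * (101 * ?s + 321) + 100"
    and out: "has_output st (encode_compressed Ws)" and cw: "compressed_word (strand_letters ?s) Ws"
    and size: "compressed_size Ws \<le> (if w = [] then 0 else 2 * (?s - 1) + ?m * (6 * (?s - 1) + 19))"
    and ev: "braid_eq g p n (ev Ws) (factor_word g p k w)"
    using combing_program_correct[OF p k w] unfolding wp_def by blast
  have s: "?s \<le> 2 * ?L" using k by (simp add: strand_index_def)
  define N where "N = ?L * max 1 ?m"
  have "1 * max 1 ?m \<le> N" unfolding N_def using p by (intro mult_le_mono1) simp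
  then have N: "?L \<le> N" "?m \<le> N" "?L * ?m \<le> N" by (simp_all add: N_def)
  have "?m * ?s \<le> 2 * (?L * ?m)" using mult_le_mono2[OF s, of ?m] by (simp add: ac_simps)
  then have ms: "?m * ?s \<le> 2 * N" using N(3) by linarith
  have "?m * (101 * ?s + 321) = 101 * (?m * ?s) + 321 * ?m" by (simp add: algebra_simps)
  then have "t \<le> 7 * g + 4 * p + 6 * ?m + 51 * ?s + (101 * (?m * ?s) + 321 * ?m) + 100"
    using t by simp
  also have "\<dots> \<le> 7 * N + 6 * N + 51 * (2 * N) + (101 * (2 * N) + 321 * N) + 100 * N"
  proof (intro add_mono mult_le_mono2 ms)
    show "7 * g + 4 * p \<le> 7 * N" using N(1) by simp
    show "?s \<le> 2 * N" using s mult_le_mono2[OF N(1), of 2] by (rule order.trans)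
    show "100 \<le> 100 * N" using N(1) p by simp
  qed (use N(2) in simp_all)
  finally have time: "t \<le> 1000 * N" by simp
  have "compressed_size Ws \<le> 19 * (2*g + p + n) * ?m"
  proof (cases "w = []")
    case True
    then show ?thesis using size by simp
  next
    case False
    then have m: "?m \<ge> 1" by (simp add: Suc_le_eq)
    have absorb: "2 * d + ?m * (6 * d + 19) \<le> ?m * (8 * d + 19)" for d
      using m mult_le_mono1[OF m, of "2 * d"] by (simp add: algebra_simps)
    have "2 * (?s - 1) + ?m * (6 * (?s - 1) + 19) \<le> ?m * (8 * (?s - 1) + 19)" by (rule absorb)
    also have "\<dots> \<le> ?m * (19 * (2*g + p + n))"
      using p k by (intro mult_le_mono2) (simp add: strand_index_def)
    finally show ?thesis using size False by (simp add: ac_simps)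
  qed
  moreover have "braid g p n (ev Ws) = combed_factor g p n k (braid g p n w)"
    using combed_factor_factor_word[OF p k w] braid_eq_iff pres_eq_words[OF ev] ev by metis
  ultimately show "\<exists>t s \<AA>.
      runs combing_program (initial_state (encode_input g p n k w)) t s \<and>
      t \<le> 1000 * ((g + p + n) * max 1 (length w)) \<and>
      has_output s (encode_compressed \<AA>) \<and>
      compressed_word {((i, strand_index g p k), b) | i b. 1 \<le> i \<and> i < strand_index g p k} \<AA> \<and>
      compressed_size \<AA> \<le> 19 * (2*g + p + n) * length w \<and>
      braid g p n (ev \<AA>) = combed_factor g p n k (braid g p n w)"
    using run time out cw unfolding N_def by blast
qed

end
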